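(* Let $m,n$ be positive integers and let $\phi:\mathbb{R}_+^n\to\mathbb{R}$ be a symmetric form that is monotone and concave on $\mathbb{R}_+^n$, extended to $\mathbf{H}_+^n$ by $\phi(A)=\phi(\boldsymbol{\lambda}(A))$. Then for any $H\in\mathbf{H}^n$ and any $\{p_j\}_{j=1}^m\subset[0,1]$ such that $\sum_{j=1}^m p_j\le 1$, the function $$(A_1,A_2,\dots,A_m)\ \longmapsto\ \phi\Big(\exp\Big(H+\sum_{j=1}^m p_j\log A_j\Big)\Big)$$ is jointly concave on $(\mathbf{H}_{++}^n)^{\times m}$. In particular, $A\mapsto\phi\big(\exp(H+\log A)\big)$ is concave on $\mathbf{H}_{++}^n$.
   Context: $\mathbb{R}_+^n=[0,+\infty)^n$. $\mathbf{H}^n$ is the space of $n\times n$ complex Hermitian matrices, and $\mathbf{H}_+^n$ (resp. $\mathbf{H}_{++}^n$) is the convex cone of positive semidefinite (resp. positive definite) ones. The matrix $\exp$ and $\log$ are defined by the spectral functional calculus. For $A\in\mathbf{H}^n$, $\boldsymbol{\lambda}(A)=(\lambda_1(A),\dots,\lambda_n(A))\in\mathbb{R}^n$ is the vector of its eigenvalues counted with multiplicity. A function $\phi:\mathbb{R}_+^n\to\mathbb{R}$ is a symmetric form if $\phi(P\boldsymbol{x})=\phi(\boldsymbol{x})$ for every $\boldsymbol{x}\in\mathbb{R}_+^n$ and every permutation $P\in S_n$ of the entries. It is monotone if $\boldsymbol{x}\ge\boldsymbol{y}$ (entrywise) implies $\phi(\boldsymbol{x})\ge\phi(\boldsymbol{y})$.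 It is concave if $\phi(\tau\boldsymbol{x}+(1-\tau)\boldsymbol{y})\ge\tau\phi(\boldsymbol{x})+(1-\tau)\phi(\boldsymbol{y})$ for all $\boldsymbol{x},\boldsymbol{y}\in\mathbb{R}_+^n$ and $\tau\in[0,1]$. Its extension to $\mathbf{H}_+^n$ is $\phi(A)=\phi(\boldsymbol{\lambda}(A))$, which is well defined by permutation invariance. *)

theory Defs
  imports "HOL-Analysis.Analysis"
begin

definition conj_transpose :: "complex^'n^'n \<Rightarrow> complex^'n^'n" where
  "conj_transpose A = (\<chi> i j. cnj (A $ j $ i))"

definition hermitian :: "complex^'n^'n \<Rightarrow> bool" where
  "hermitian A \<longleftrightarrow> conj_transpose A = A"

definition unitary :: "complex^'n^'n \<Rightarrow> bool" where
  "unitary U \<longleftrightarrow> conj_transpose U ** U = mat 1 \<and> U ** conj_transpose U = mat 1"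

text \<open>The quadratic form of a Hermitian matrix is real-valued, so taking its real part loses
  nothing.\<close>

definition pos_def :: "complex^'n^'n \<Rightarrow> bool" where
  "pos_def A \<longleftrightarrow> hermitian A \<and>
     (\<forall>x. x \<noteq> 0 \<longrightarrow> 0 < Re (\<Sum>i\<in>UNIV. cnj (x $ i) * (A *v x) $ i))"

definition real_diag :: "real^'n \<Rightarrow> complex^'n^'n" where
  "real_diag d = (\<chi> i j. if i = j then complex_of_real (d $ i) else 0)"

text \<open>Spectral functional calculus: \<open>f (U D U\<^sup>*) = U (f D) U\<^sup>*\<close>. For Hermitian \<open>A\<close> a unitary
  diagonalization exists and the resulting matrix does not depend on it. For matrices that are
  not Hermitian the value is unspecified.\<close>

definition matrix_fun :: "(real \<Rightarrow> real) \<Rightarrow> complex^'n^'n \<Rightarrow> complex^'n^'n" where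
  "matrix_fun f A = (THE B. \<exists>U d. unitary U \<and>
     A = U ** real_diag d ** conj_transpose U \<and>
     B = U ** real_diag (\<chi> i. f (d $ i)) ** conj_transpose U)"

definition matrix_exp :: "complex^'n^'n \<Rightarrow> complex^'n^'n" where
  "matrix_exp = matrix_fun exp"

definition matrix_log :: "complex^'n^'n \<Rightarrow> complex^'n^'n" where
  "matrix_log = matrix_fun ln"

text \<open>The eigenvalues counted with multiplicity are the roots of the characteristic polynomial
  \<open>det (z I - A)\<close>, real for Hermitian \<open>A\<close>. This determines the vector up to a permutation of its
  entries; an arbitrary ordering is chosen.\<close>

definition eigenvalue_vector :: "complex^'n^'n \<Rightarrow> real^'n" where
  "eigenvalue_vector A =
     (SOME v. \<forall>z. det (mat z - A) = (\<Prod>i\<in>UNIV. z - complex_of_real (v $ i)))"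

text \<open>Functions on \<open>[0,\<infinity>)\<^sup>n\<close> are total functions on \<open>real^'n\<close> whose values outside the orthant
  are never constrained nor used.\<close>

definition nonneg_orthant :: "(real^'n) set" where
  "nonneg_orthant = {x. \<forall>i. 0 \<le> x $ i}"

definition symmetric_form :: "(real^'n \<Rightarrow> real) \<Rightarrow> bool" where
  "symmetric_form \<phi> \<longleftrightarrow>
     (\<forall>x\<in>nonneg_orthant. \<forall>\<pi>. \<pi> permutes UNIV \<longrightarrow> \<phi> (\<chi> i. x $ \<pi> i) = \<phi> x)"

definition spectral_extension :: "(real^'n \<Rightarrow> real) \<Rightarrow> complex^'n^'n \<Rightarrow> real" where
  "spectral_extension \<phi> A = \<phi> (eigenvalue_vector A)"

end

theory Submission
  imports Defs
begin

text \<open>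
  Write \<open>K(A) = H + \<Sum>\<^sub>j p\<^sub>j log A\<^sub>j\<close>. The theorem is deduced from its special case \<open>\<phi> = trace\<close>, Lieb's
  concavity theorem, by letting the Hermitian matrix \<open>H\<close> vary.

  Lieb's theorem (\<open>lieb_concavity\<close>) comes from the Gibbs variational principle: \<open>tr exp L\<close> is the
  maximum over positive definite \<open>X\<close> of \<open>tr X L - tr X log X + tr X\<close>, attained at \<open>X = exp L\<close>.
  For \<open>L = K(A)\<close> the maximand is affine in \<open>X\<close> minus a nonnegative combination of relative entropies
  \<open>D(X, A\<^sub>j) = tr X (log X - log A\<^sub>j)\<close> and \<open>D(X, 1)\<close>; this is where \<open>\<Sum>\<^sub>j p\<^sub>j \<le> 1\<close> enters. As the relative
  entropy is jointly convex, the maximand is jointly concave in \<open>(X, A)\<close>, and so its maximum over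
  \<open>X\<close> is concave in \<open>A\<close>.

  Joint convexity of the relative entropy (\<open>rel_entropy_jointly_convex\<close>) is obtained by following
  \<open>log X - log ((1 - t) X + t A)\<close> for \<open>t\<close> from \<open>0\<close> to \<open>1\<close>, where \<open>X\<close> and \<open>A\<close> stand for the commuting
  operators of left multiplication by \<open>X\<close> and right multiplication by \<open>A\<close>. Up to positive factors and
  a linear term, the derivative of its trace against \<open>X\<close> is minus a parallel sum of \<open>(1 - t) X\<close> and
  \<open>t A\<close>. The parallel sum of \<open>X\<close> and \<open>A\<close> is the minimum over all matrices \<open>Z\<close> of \<open>tr Z\<^sup>* X Z + tr (1 - Z) A (1 - Z)\<^sup>*\<close>, which is linear in \<open>(X, A)\<close>,
  so it is jointly concave. In eigenbases of \<open>X\<close> and \<open>A\<close> all of these are explicit finite double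
  sums.

  From the trace to \<open>\<phi>\<close>: let \<open>S\<^sub>k(A)\<close> be the sum of the \<open>k\<close> smallest eigenvalues of \<open>exp K(A)\<close>. By
  interlacing, \<open>S\<^sub>k(A) \<le> tr exp (K(A) - t Q)\<close> for every \<open>t\<close> and every orthogonal projection \<open>Q\<close> of rank
  \<open>n - k\<close>, and the bound becomes sharp when \<open>Q\<close> projects onto the eigenvectors of \<open>K(A)\<close> for its
  \<open>n - k\<close> largest eigenvalues and \<open>t \<rightarrow> \<infinity>\<close>. Replacing \<open>H\<close> by \<open>H - t Q\<close> in Lieb's theorem, \<open>S\<^sub>k\<close> is an
  infimum of concave functions (\<open>smallest_exp_sum_concave\<close>). Finally \<open>\<phi>\<close>, being concave, lies below its
  supporting linear functions; monotonicity makes their weights nonnegative, symmetry lets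
  these be paired with the eigenvalues in opposite order, and summation by parts expresses the result
  through the \<open>S\<^sub>k\<close> (\<open>symmetric_concave_of_partial_sums\<close>).
\<close>

section \<open>Adjoints, traces and unitary diagonalizations\<close>

abbreviation adj :: "complex^'n^'n \<Rightarrow> complex^'n^'n" where
  "adj \<equiv> conj_transpose"

definition cinner :: "complex^'n \<Rightarrow> complex^'n \<Rightarrow> complex" where
  "cinner x y = (\<Sum>i\<in>UNIV. cnj (x $ i) * y $ i)"

definition re_trace :: "complex^'n^'n \<Rightarrow> real" where
  "re_trace A = Re (trace A)"

definition diagonalizes :: "complex^'n^'n \<Rightarrow> real^'n \<Rightarrow> complex^'n^'n \<Rightarrow> bool" where
  "diagonalizes U d A \<longleftrightarrow> unitary U \<and> A = U ** real_diag d ** adj U"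

lemma adj_nth [simp]: "adj A $ i $ j = cnj (A $ j $ i)"
  by (simp add: conj_transpose_def)

lemma adj_adj [simp]: "adj (adj A) = A"
  by (simp add: vec_eq_iff)

lemma adj_mult: "adj (A ** B) = adj B ** adj A"
  by (simp add: vec_eq_iff matrix_matrix_mult_def mult.commute)

lemma adj_add [simp]: "adj (A + B) = adj A + adj B"
  by (simp add: vec_eq_iff)

lemma adj_scaleR [simp]: "adj (c *\<^sub>R A) = c *\<^sub>R adj A"
  by (simp add: vec_eq_iff)

lemma adj_sum [simp]: "adj (\<Sum>j\<in>S. A j) = (\<Sum>j\<in>S. adj (A j))"
  by (simp add: vec_eq_iff)

lemma adj_real_diag [simp]: "adj (real_diag d) = real_diag d"
  by (auto simp: vec_eq_iff real_diag_def)

lemma mult_add_left: "(A + B) ** C = A ** C + B ** C" for A B C :: "complex^'n^'n"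
  by (simp add: vec_eq_iff matrix_matrix_mult_def distrib_right sum.distrib)

lemma scaleR_mult_left: "(c *\<^sub>R A) ** B = c *\<^sub>R (A ** B)" for A B :: "complex^'n^'n"
  by (simp add: vec_eq_iff matrix_matrix_mult_def scaleR_sum_right)

lemma scaleR_mult_right: "A ** (c *\<^sub>R B) = c *\<^sub>R (A ** B)" for A B :: "complex^'n^'n"
  by (simp add: vec_eq_iff matrix_matrix_mult_def scaleR_sum_right)

lemma mult_sum_right: "A ** (\<Sum>j\<in>S. B j) = (\<Sum>j\<in>S. A ** B j)" for A :: "complex^'n^'n"
  by (simp add: vec_eq_iff matrix_matrix_mult_def sum_distrib_left) (intro allI, rule sum.swap)

lemma re_trace_add: "re_trace (A + B) = re_trace A + re_trace B"
  by (simp add: re_trace_def trace_add)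

lemma re_trace_scaleR: "re_trace (c *\<^sub>R A) = c * re_trace A"
  by (simp add: re_trace_def trace_def sum_distrib_left)

lemma re_trace_sum: "re_trace (\<Sum>j\<in>S. A j) = (\<Sum>j\<in>S. re_trace (A j))"
  by (simp add: re_trace_def trace_def) (rule sum.swap)

lemma re_trace_comm: "re_trace (A ** B) = re_trace (B ** A)"
  unfolding re_trace_def by (rule arg_cong [OF trace_mul_sym])

lemmas re_trace_linear = re_trace_add re_trace_scaleR re_trace_sum
  matrix_add_ldistrib mult_add_left scaleR_mult_left scaleR_mult_right mult_sum_right

lemma Re_cinner: "Re (cinner x y) = x \<bullet> y"
  by (simp add: cinner_def inner_vec_def inner_complex_def)

lemma cinner_self: "cinner x x = of_real ((norm x)\<^sup>2)"
proof -
  have "Im (cinner x x) = 0"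
    by (simp add: cinner_def mult.commute)
  then show ?thesis
    by (simp add: complex_eq_iff Re_cinner power2_norm_eq_inner)
qed

lemma cinner_add_right: "cinner x (y + z) = cinner x y + cinner x z"
  by (simp add: cinner_def distrib_left sum.distrib)

lemma cinner_scaleR_right: "cinner x (c *\<^sub>R y) = of_real c * cinner x y"
  by (simp add: cinner_def scaleR_sum_right flip: scaleR_conv_of_real)

lemma cinner_commute: "cinner y x = cnj (cinner x y)"
  by (simp add: cinner_def mult.commute)

lemma cinner_adj: "cinner x (A *v y) = cinner (adj A *v x) y"
proof -
  have "cinner x (A *v y) = (\<Sum>i\<in>UNIV. \<Sum>j\<in>UNIV. cnj (x $ i) * (A $ i $ j * y $ j))"
    by (simp add: cinner_def matrix_vector_mult_def sum_distrib_left)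
  also have "\<dots> = (\<Sum>j\<in>UNIV. \<Sum>i\<in>UNIV. cnj (x $ i) * (A $ i $ j * y $ j))"
    by (rule sum.swap)
  also have "\<dots> = cinner (adj A *v x) y"
    by (simp add: cinner_def matrix_vector_mult_def sum_distrib_left mult_ac)
  finally show ?thesis .
qed

lemma unitary_adj: "unitary U \<Longrightarrow> unitary (adj U)"
  by (simp add: unitary_def)

lemma unitary_mult:
  assumes "unitary U" "unitary V"
  shows "unitary (U ** V)"
proof -
  have "adj V ** adj U ** (U ** V) = adj V ** (adj U ** U) ** V"
    and "U ** V ** (adj V ** adj U) = U ** (V ** adj V) ** adj U"
    by (simp_all only: matrix_mul_assoc)
  with assms show ?thesis
    by (simp add: unitary_def adj_mult)
qed

lemma unitary_cancel:
  assumes "unitary U"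
  shows "adj U ** (U ** A) = A" "U ** (adj U ** A) = A"
    "A ** U ** adj U = A" "A ** adj U ** U = A"
  using assms by (simp_all add: unitary_def matrix_mul_assoc)
    (simp_all add: matrix_mul_assoc [symmetric])

lemma unitary_row_sum:
  assumes "unitary U"
  shows "(\<Sum>j\<in>UNIV. (cmod (U $ i $ j))\<^sup>2) = 1"
proof -
  have "complex_of_real (\<Sum>j\<in>UNIV. (cmod (U $ i $ j))\<^sup>2) = (U ** adj U) $ i $ i"
    unfolding matrix_matrix_mult_def of_real_sum complex_norm_square by simp
  also have "\<dots> = 1"
    using assms by (simp add: unitary_def mat_def)
  finally show ?thesis
    using of_real_eq_1_iff by blast
qed

lemma unitary_column_sum:
  assumes "unitary U"
  shows "(\<Sum>i\<in>UNIV. (cmod (U $ i $ j))\<^sup>2) = 1"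
  using unitary_row_sum [OF unitary_adj [OF assms], of j] by simp

lemma norm_unitary:
  assumes "unitary U"
  shows "norm (U *v x) = norm x"
proof -
  have "cinner (U *v x) (U *v x) = cinner x x"
    using assms by (simp add: cinner_adj matrix_vector_mul_assoc unitary_def)
  then have "(norm (U *v x))\<^sup>2 = (norm x)\<^sup>2"
    unfolding cinner_self by (simp only: of_real_eq_iff)
  then show ?thesis
    by simp
qed

lemma norm_sq_vec: "(norm x)\<^sup>2 = (\<Sum>i\<in>UNIV. (cmod (x $ i))\<^sup>2)" for x :: "complex^'n"
  by (simp add: power2_norm_eq_inner inner_vec_def)

lemma real_diag_mult_left [simp]: "(real_diag d ** A) $ i $ j = of_real (d $ i) * A $ i $ j"
proof -
  have "(real_diag d ** A) $ i $ j = (\<Sum>k\<in>UNIV. if k = i then of_real (d $ i) * A $ i $ j else 0)"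
    unfolding matrix_matrix_mult_def vec_lambda_beta real_diag_def
    by (rule sum.cong) auto
  then show ?thesis
    by simp
qed

lemma real_diag_mult_right [simp]: "(A ** real_diag d) $ i $ j = A $ i $ j * of_real (d $ j)"
proof -
  have "(A ** real_diag d) $ i $ j = (\<Sum>k\<in>UNIV. if k = j then A $ i $ j * of_real (d $ j) else 0)"
    unfolding matrix_matrix_mult_def vec_lambda_beta real_diag_def
    by (rule sum.cong) auto
  then show ?thesis
    by simp
qed

lemma real_diag_mult_vec [simp]: "(real_diag d *v x) $ i = of_real (d $ i) * x $ i"
proof -
  have "(real_diag d *v x) $ i = (\<Sum>k\<in>UNIV. if k = i then of_real (d $ i) * x $ i else 0)"
    unfolding matrix_vector_mult_def vec_lambda_beta real_diag_def
    by (rule sum.cong) auto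
  then show ?thesis
    by simp
qed

lemma hermitian_diagonalizes: "diagonalizes U d A \<Longrightarrow> hermitian A"
  by (simp add: diagonalizes_def hermitian_def adj_mult matrix_mul_assoc)

lemma adj_mat1 [simp]: "adj (mat 1) = mat 1"
  by (simp add: vec_eq_iff mat_def)

lemma unitary_mat1: "unitary (mat 1)"
  by (simp add: unitary_def)

lemma diagonalizes_mat1: "unitary U \<Longrightarrow> diagonalizes U (\<chi> i. 1) (mat 1)"
proof -
  have *: "real_diag (\<chi> i. 1) = (mat 1 :: complex^'n^'n)"
    by (simp add: vec_eq_iff real_diag_def mat_def)
  show "unitary U \<Longrightarrow> ?thesis"
    by (simp add: diagonalizes_def *) (simp add: unitary_def)
qed

lemma diagonalizes_add:
  assumes "diagonalizes U a A" "diagonalizes U b B"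
  shows "diagonalizes U (a + b) (A + B)"
proof -
  have "real_diag (a + b) = real_diag a + real_diag b"
    by (simp add: vec_eq_iff real_diag_def)
  with assms show ?thesis
    by (simp add: diagonalizes_def matrix_add_ldistrib mult_add_left)
qed

lemma cinner_diagonalizes:
  assumes "diagonalizes U d A"
  shows "Re (cinner x (A *v x)) = (\<Sum>i\<in>UNIV. d $ i * (cmod ((adj U *v x) $ i))\<^sup>2)"
proof -
  let ?c = "adj U *v x"
  have "cinner x (A *v x) = cinner ?c (real_diag d *v ?c)"
    using assms
    by (simp add: diagonalizes_def matrix_vector_mul_assoc [symmetric] cinner_adj)
  also have "\<dots> = (\<Sum>i\<in>UNIV. of_real (d $ i * (cmod (?c $ i))\<^sup>2))"
    unfolding cinner_def real_diag_mult_vec of_real_mult complex_norm_square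
    by (simp add: mult_ac)
  finally show ?thesis
    by simp
qed

lemma re_trace_diagonalizes:
  assumes "diagonalizes U d A"
  shows "re_trace A = (\<Sum>i\<in>UNIV. d $ i)"
proof -
  have "re_trace A = re_trace (adj U ** (U ** real_diag d))"
    using assms by (metis diagonalizes_def re_trace_comm)
  also have "\<dots> = re_trace (real_diag d)"
    using assms by (simp add: diagonalizes_def unitary_cancel)
  also have "\<dots> = (\<Sum>i\<in>UNIV. d $ i)"
    by (simp add: re_trace_def trace_def real_diag_def)
  finally show ?thesis .
qed

lemma re_trace_adj_diag_mult:
  "re_trace (adj Y ** (real_diag x ** Y)) =
    (\<Sum>j\<in>UNIV. \<Sum>i\<in>UNIV. x $ i * (cmod (Y $ i $ j))\<^sup>2)"
  by (simp add: re_trace_def trace_def matrix_matrix_mult_def [of "adj Y"] cmod_power2)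
    (simp add: power2_eq_square algebra_simps)

lemma re_trace_diag_mult_diag_adj:
  "re_trace (real_diag x ** (Y ** real_diag a ** adj Y)) =
    (\<Sum>i\<in>UNIV. x $ i * (\<Sum>j\<in>UNIV. a $ j * (cmod (Y $ i $ j))\<^sup>2))"
  by (simp add: re_trace_def trace_def matrix_matrix_mult_def [of "Y ** real_diag a"] cmod_power2)
    (simp add: power2_eq_square algebra_simps)

text \<open>The next two lemmas write both kinds of trace in the same coordinates \<open>U\<^sup>* Z V\<close>, so that they can
  be added and minimized over \<open>Z\<close> entry by entry.\<close>

lemma re_trace_sandwich_left:
  assumes "diagonalizes U x X" "unitary V"
  shows "re_trace (adj Z ** X ** Z) =
    (\<Sum>i\<in>UNIV. \<Sum>j\<in>UNIV. x $ i * (cmod ((adj U ** Z ** V) $ i $ j))\<^sup>2)"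
proof -
  let ?Y = "adj U ** Z ** V"
  have "re_trace (adj Z ** X ** Z) = re_trace (V ** (adj V ** (adj Z ** X ** Z)))"
    using assms by (simp add: unitary_cancel)
  also have "\<dots> = re_trace (adj V ** (adj Z ** X ** Z) ** V)"
    by (rule re_trace_comm)
  also have "\<dots> = re_trace (adj ?Y ** (real_diag x ** ?Y))"
    using assms by (simp add: diagonalizes_def adj_mult matrix_mul_assoc)
  also have "\<dots> = (\<Sum>j\<in>UNIV. \<Sum>i\<in>UNIV. x $ i * (cmod (?Y $ i $ j))\<^sup>2)"
    by (rule re_trace_adj_diag_mult)
  also have "\<dots> = (\<Sum>i\<in>UNIV. \<Sum>j\<in>UNIV. x $ i * (cmod (?Y $ i $ j))\<^sup>2)"
    by (rule sum.swap)
  finally show ?thesis .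
qed

lemma re_trace_sandwich_right:
  assumes "diagonalizes V a A" "unitary U"
  shows "re_trace (Z ** A ** adj Z) =
    (\<Sum>i\<in>UNIV. \<Sum>j\<in>UNIV. a $ j * (cmod ((adj U ** Z ** V) $ i $ j))\<^sup>2)"
proof -
  have eq: "(adj V ** adj Z ** U) = adj (adj U ** Z ** V)"
    by (simp add: adj_mult matrix_mul_assoc)
  have "re_trace (adj (adj Z) ** A ** adj Z) =
    (\<Sum>j\<in>UNIV. \<Sum>i\<in>UNIV. a $ j * (cmod ((adj U ** Z ** V) $ i $ j))\<^sup>2)"
    using re_trace_sandwich_left [OF assms, of "adj Z"] unfolding eq by simp
  also have "\<dots> = (\<Sum>i\<in>UNIV. \<Sum>j\<in>UNIV. a $ j * (cmod ((adj U ** Z ** V) $ i $ j))\<^sup>2)"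
    by (rule sum.swap)
  finally show ?thesis
    by simp
qed

lemma re_trace_mult_diagonalizes:
  assumes X: "diagonalizes U x X" and A: "diagonalizes V a A"
  shows "re_trace (X ** A) =
    (\<Sum>i\<in>UNIV. \<Sum>j\<in>UNIV. (cmod ((adj U ** V) $ i $ j))\<^sup>2 * (x $ i * a $ j))"
proof -
  let ?W = "adj U ** V"
  have "re_trace (X ** A) = re_trace (U ** (real_diag x ** adj U ** A))"
    using X by (simp add: diagonalizes_def matrix_mul_assoc)
  also have "\<dots> = re_trace (real_diag x ** adj U ** A ** U)"
    by (rule re_trace_comm)
  also have "\<dots> = re_trace (real_diag x ** ((?W ** real_diag a) ** adj ?W))"
    using A by (simp add: diagonalizes_def adj_mult matrix_mul_assoc)
  also have "\<dots> = (\<Sum>i\<in>UNIV. x $ i * (\<Sum>j\<in>UNIV. a $ j * (cmod (?W $ i $ j))\<^sup>2))"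
    by (rule re_trace_diag_mult_diag_adj)
  finally show ?thesis
    by (simp add: sum_distrib_left mult_ac)
qed

section \<open>The spectral theorem and the functional calculus\<close>

text \<open>If the homogeneous system with coefficient vectors \<open>R\<close> had only the zero solution, these fewer than
  \<open>n\<close> vectors would span the whole space.\<close>

lemma exists_nonzero_annihilated:
  fixes R :: "(complex^'n) set"
  assumes "finite R" "card R < CARD('n)"
  obtains x where "x \<noteq> 0" "\<And>r. r \<in> R \<Longrightarrow> (\<Sum>i\<in>UNIV. r $ i * x $ i) = 0"
proof (cases "R = {}")
  case True
  then show ?thesis
    using that [of 1] by simp
next
  case False
  have "card R \<le> CARD('n)"
    using assms by simp
  then obtain f :: "complex^'n \<Rightarrow> 'n" where "inj_on f R"
    using card_le_inj [of R "UNIV :: 'n set"] assms(1) by auto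
  then obtain g :: "'n \<Rightarrow> complex^'n" where g: "R = g ` UNIV"
    using inj_on_iff_surj [of R "UNIV :: 'n set"] False by blast
  define M :: "complex^'n^'n" where "M = (\<chi> i. g i)"
  have rows: "rows M = R"
    by (auto simp: rows_def row_def M_def g)
  have "vec.span (rows M) \<noteq> UNIV"
  proof
    assume "vec.span (rows M) = UNIV"
    then have "vec.dim (UNIV :: (complex^'n) set) \<le> card R"
      using vec.dim_le_card [of UNIV R] assms(1) rows by simp
    then show False
      using assms(2) by (simp add: card_cart_basis vec.dimension_def)
  qed
  then obtain x where "M *v x = 0" "x \<noteq> 0"
    using matrix_left_invertible_ker [of M] matrix_left_invertible_span_rows_gen [of M] by blast
  then show ?thesis
    using that [of x] by (auto simp: g M_def vec_eq_iff matrix_vector_mult_def)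
qed

lemma mult_vec_add: "A *v (x + y) = A *v x + A *v y" for A :: "complex^'n^'n"
  by (simp add: vec_eq_iff matrix_vector_mult_def distrib_left sum.distrib)

lemma mult_vec_scaleR: "A *v (c *\<^sub>R x) = c *\<^sub>R (A *v x)" for A :: "complex^'n^'n"
  by (simp add: vec_eq_iff matrix_vector_mult_def scaleR_sum_right)

lemma hermitian_self_adjoint:
  "hermitian A \<Longrightarrow> cinner x (A *v y) = cinner (A *v x) y"
  by (simp add: cinner_adj hermitian_def)

text \<open>A unit vector that maximizes the quadratic form of \<open>A\<close> among the unit vectors orthogonal to
  given eigenvectors is again an eigenvector. The residual \<open>z = c v - A v\<close> is itself orthogonal
  to these eigenvectors, so that moving from \<open>v\<close> in direction \<open>-z\<close> is allowed; since
  \<open>c \<bar>y\<bar>\<^sup>2 - \<langle>y, A y\<rangle>\<close> is nonnegative on the orthogonal complement and vanishes at \<open>v\<close>, its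
  derivative at \<open>v\<close> must vanish in this direction, which gives \<open>z = 0\<close>.\<close>

lemma exists_orthogonal_eigenvector:
  fixes A :: "complex^'n^'n"
  assumes A: "hermitian A" and S: "finite S" "card S < CARD('n)"
    and eig: "\<And>s. s \<in> S \<Longrightarrow> \<exists>c::real. A *v s = c *\<^sub>R s"
  obtains v c where "norm v = 1" "A *v v = c *\<^sub>R v" "\<And>s. s \<in> S \<Longrightarrow> cinner s v = 0"
proof -
  define N where "N = {x. \<forall>s\<in>S. cinner s x = 0}"
  define q where "q = (\<lambda>x. x \<bullet> (A *v x))"
  have N_add: "x + y \<in> N" if "x \<in> N" "y \<in> N" for x y
    using that by (simp add: N_def cinner_add_right)
  have N_scale: "c *\<^sub>R x \<in> N" if "x \<in> N" for c x
    using that by (simp add: N_def cinner_scaleR_right)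
  have N_A: "A *v x \<in> N" if "x \<in> N" for x
    unfolding N_def
  proof (clarify)
    fix s assume "s \<in> S"
    then obtain c :: real where "A *v s = c *\<^sub>R s"
      using eig by blast
    then have "cinner s (A *v x) = cnj (of_real c * cinner x s)"
      using hermitian_self_adjoint [OF A, of s x]
      by (metis cinner_commute cinner_scaleR_right)
    then show "cinner s (A *v x) = 0"
      using that \<open>s \<in> S\<close> cinner_commute [of s x] by (simp add: N_def)
  qed
  have few: "card ((\<lambda>s. \<chi> i. cnj (s $ i)) ` S) < CARD('n)"
    using card_image_le [OF S(1)] S(2) by (rule le_less_trans)
  obtain x0 :: "complex^'n" where "x0 \<noteq> 0"
    and ann: "\<And>r. r \<in> (\<lambda>s. \<chi> i. cnj (s $ i)) ` S \<Longrightarrow> (\<Sum>i\<in>UNIV. r $ i * x0 $ i) = 0"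
    by (rule exists_nonzero_annihilated [OF finite_imageI [OF S(1)] few]) blast
  then have x0: "x0 \<noteq> 0" "x0 \<in> N"
    using ann by (fastforce simp: N_def cinner_def)+
  define K where "K = sphere 0 1 \<inter> N"
  have "(1 / norm x0) *\<^sub>R x0 \<in> K"
    using x0 N_scale by (simp add: K_def)
  then have "K \<noteq> {}"
    by blast
  have "compact K"
  proof -
    have "N = (\<Inter>s\<in>S. {x. cinner s x = 0})"
      by (auto simp: N_def)
    moreover have "closed {x. cinner s x = 0}" for s :: "complex^'n"
      unfolding cinner_def by (intro closed_Collect_eq continuous_intros)
    ultimately have "closed N"
      by auto
    then show ?thesis
      unfolding K_def by (intro compact_Int_closed compact_sphere)
  qed
  have "continuous_on K q"
    unfolding q_def Re_cinner [symmetric] cinner_def matrix_vector_mult_def vec_lambda_beta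
    by (intro continuous_intros)
  obtain v where v: "v \<in> K" and max: "\<And>y. y \<in> K \<Longrightarrow> q y \<le> q v"
    using continuous_attains_sup [OF \<open>compact K\<close> \<open>K \<noteq> {}\<close> \<open>continuous_on K q\<close>] by blast
  have norm_v: "norm v = 1" and "v \<in> N"
    using v by (auto simp: K_def)
  define c where "c = q v"
  define z where "z = c *\<^sub>R v - A *v v"
  define g where "g = (\<lambda>y. c * (y \<bullet> y) - q y)"
  have g_nonneg: "g y \<ge> 0" if "y \<in> N" for y
  proof (cases "y = 0")
    case False
    have "(1 / norm y) *\<^sub>R y \<in> K"
      using False that N_scale by (simp add: K_def)
    then have "q ((1 / norm y) *\<^sub>R y) \<le> c"
      unfolding c_def by (rule max)
    then have "q y / (norm y)\<^sup>2 \<le> c"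
      by (simp add: q_def mult_vec_scaleR power2_eq_square)
    then show ?thesis
      using False by (simp add: g_def power2_norm_eq_inner field_simps)
  qed (simp add: g_def q_def)
  have "z \<in> N"
    using N_add [OF N_scale [OF \<open>v \<in> N\<close>, of c] N_scale [OF N_A [OF \<open>v \<in> N\<close>], of "-1"]]
    by (simp add: z_def)
  have sym: "z \<bullet> (A *v v) = v \<bullet> (A *v z)"
    using hermitian_self_adjoint [OF A, of v z] by (metis Re_cinner inner_commute)
  have expand: "g (v - s *\<^sub>R z) = s\<^sup>2 * g z - 2 * s * (z \<bullet> z)" for s
  proof -
    have "v - s *\<^sub>R z = v + (- s) *\<^sub>R z"
      by simp
    then have Av: "A *v (v - s *\<^sub>R z) = A *v v - s *\<^sub>R (A *v z)"
      by (simp only: mult_vec_add mult_vec_scaleR) simp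
    have "g (v - s *\<^sub>R z) = g v - 2 * s * (c * (v \<bullet> z) - z \<bullet> (A *v v)) + s\<^sup>2 * g z"
      unfolding g_def q_def Av
      by (simp add: inner_diff_left inner_diff_right sym inner_commute [of z v]
          power2_eq_square algebra_simps)
    moreover have "g v = 0"
      using norm_v by (simp add: g_def c_def flip: power2_norm_eq_inner)
    moreover have "c * (v \<bullet> z) - z \<bullet> (A *v v) = z \<bullet> z"
      unfolding z_def by (simp add: inner_diff_left inner_diff_right inner_commute algebra_simps)
    ultimately show ?thesis
      by simp
  qed
  have small: "2 * (z \<bullet> z) \<le> s * g z" if "s > 0" for s
  proof -
    have "v - s *\<^sub>R z \<in> N"
      using N_add [OF \<open>v \<in> N\<close> N_scale [OF \<open>z \<in> N\<close>, of "- s"]] by simp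
    then have "s * (2 * (z \<bullet> z)) \<le> s * (s * g z)"
      using g_nonneg [of "v - s *\<^sub>R z"] expand [of s] by (simp add: power2_eq_square algebra_simps)
    then show ?thesis
      using that by simp
  qed
  have "z \<bullet> z \<le> 0"
  proof (rule ccontr)
    assume pos: "\<not> z \<bullet> z \<le> 0"
    then have "g z > 0"
      using small [of 1] by linarith
    then have "2 * (z \<bullet> z) \<le> (z \<bullet> z) / g z * g z"
      using pos by (intro small divide_pos_pos) auto
    then show False
      using \<open>g z > 0\<close> pos by simp
  qed
  then have "z = 0"
    by (metis inner_eq_zero_iff inner_ge_zero order_antisym)
  then have "A *v v = c *\<^sub>R v"
    by (simp add: z_def)
  then show ?thesis
    using that norm_v \<open>v \<in> N\<close> by (auto simp: N_def)
qed

lemma exists_orthonormal_eigenvectors: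
  fixes A :: "complex^'n^'n" and J :: "'n set"
  assumes "hermitian A"
  shows "\<exists>u d. \<forall>i\<in>J. A *v u i = d i *\<^sub>R u i \<and>
    (\<forall>j\<in>J. cinner (u i) (u j) = (if i = j then 1 else 0))"
proof (rule finite_induct [of J], simp)
  fix k and J :: "'n set"
  assume "k \<notin> J" and "\<exists>u d. \<forall>i\<in>J. A *v u i = d i *\<^sub>R u i \<and>
    (\<forall>j\<in>J. cinner (u i) (u j) = (if i = j then 1 else 0))"
  then obtain u d where u: "\<And>i. i \<in> J \<Longrightarrow> A *v u i = d i *\<^sub>R u i"
      "\<And>i j. i \<in> J \<Longrightarrow> j \<in> J \<Longrightarrow> cinner (u i) (u j) = (if i = j then 1 else 0)"
    by blast
  have "card (u ` J) < CARD('n)"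
    using \<open>k \<notin> J\<close> by (metis card_image_le finite le_less_trans psubset_card_mono psubsetI
        subset_UNIV UNIV_I)
  note few = this
  obtain v c where v: "norm v = 1" "A *v v = c *\<^sub>R v" "\<And>s. s \<in> u ` J \<Longrightarrow> cinner s v = 0"
    by (rule exists_orthogonal_eigenvector [OF assms finite_imageI [OF finite] few]) (auto intro: u(1))
  then have "cinner v v = 1" "\<And>i. i \<in> J \<Longrightarrow> cinner (u i) v = 0" "\<And>i. i \<in> J \<Longrightarrow> cinner v (u i) = 0"
    using cinner_commute [of v] by (auto simp: cinner_self)
  then show "\<exists>u d. \<forall>i\<in>insert k J. A *v u i = d i *\<^sub>R u i \<and>
    (\<forall>j\<in>insert k J. cinner (u i) (u j) = (if i = j then 1 else 0))"
    using u v(2) \<open>k \<notin> J\<close>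
    by (intro exI [of _ "u(k := v)"] exI [of _ "d(k := c)"]) auto
qed simp

theorem hermitian_diagonalizable:
  fixes A :: "complex^'n^'n"
  assumes "hermitian A"
  obtains U d where "diagonalizes U d A"
proof -
  obtain u :: "'n \<Rightarrow> complex^'n" and d where eig: "\<And>j. A *v u j = d j *\<^sub>R u j"
    and on: "\<And>i j. cinner (u i) (u j) = (if i = j then 1 else 0)"
    using exists_orthonormal_eigenvectors [OF assms, of UNIV] by auto
  define U where "U = (\<chi> i j. u j $ i)"
  have UU: "adj U ** U = mat 1"
    using on by (simp add: vec_eq_iff matrix_matrix_mult_def mat_def U_def cinner_def)
  then have unitary: "unitary U"
    using matrix_left_right_inverse by (auto simp: unitary_def)
  have "(A ** U) $ i $ j = (A *v u j) $ i" for i j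
    by (simp add: matrix_matrix_mult_def matrix_vector_mult_def U_def)
  then have "A ** U = U ** real_diag (\<chi> j. d j)"
    by (simp add: vec_eq_iff eig U_def scaleR_conv_of_real [where 'a = complex] mult.commute)
  then have "A = U ** real_diag (\<chi> j. d j) ** adj U"
    using unitary by (metis unitary_cancel(3))
  then show ?thesis
    using that unitary by (auto simp: diagonalizes_def)
qed

text \<open>Two diagonalizations of the same matrix are linked by a unitary \<open>W\<close> with
  \<open>W\<^sub>i\<^sub>j d\<^sub>j = e\<^sub>i W\<^sub>i\<^sub>j\<close>; so \<open>W\<close> only connects indices with equal eigenvalues and intertwines the
  values of any function of them as well.\<close>

lemma matrix_fun_diagonalizes:
  assumes A: "diagonalizes U d A"
  shows "diagonalizes U (\<chi> i. f (d $ i)) (matrix_fun f A)"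
proof -
  let ?B = "U ** real_diag (\<chi> i. f (d $ i)) ** adj U"
  have unique: "V ** real_diag (\<chi> i. f (e $ i)) ** adj V = ?B" if V: "diagonalizes V e A" for V e
  proof -
    let ?W = "adj V ** U"
    have "V ** real_diag e ** adj V = U ** real_diag d ** adj U"
      using A V by (simp add: diagonalizes_def)
    then have "adj V ** (V ** real_diag e ** adj V) ** U = adj V ** (U ** real_diag d ** adj U) ** U"
      by simp
    then have "real_diag e ** ?W = ?W ** real_diag d"
      using A V by (simp add: diagonalizes_def matrix_mul_assoc [symmetric] unitary_cancel
          unitary_def)
    then have "of_real (e $ i) * ?W $ i $ j = ?W $ i $ j * of_real (d $ j)" for i j
      by (metis real_diag_mult_left real_diag_mult_right)
    then have "?W $ i $ j = 0 \<or> e $ i = d $ j" for i j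
      by (metis mult.commute mult_cancel_left of_real_eq_iff)
    then have "of_real (f (e $ i)) * ?W $ i $ j = ?W $ i $ j * of_real (f (d $ j))" for i j
      by (metis mult.commute mult_zero_right)
    then have "real_diag (\<chi> i. f (e $ i)) ** ?W = ?W ** real_diag (\<chi> i. f (d $ i))"
      by (simp add: vec_eq_iff)
    then have "V ** (real_diag (\<chi> i. f (e $ i)) ** ?W) ** adj U
        = V ** (?W ** real_diag (\<chi> i. f (d $ i))) ** adj U"
      by simp
    then show ?thesis
      using A V by (simp add: diagonalizes_def matrix_mul_assoc [symmetric] unitary_cancel
          unitary_def)
  qed
  have "matrix_fun f A = ?B"
    unfolding matrix_fun_def
  proof (rule the_equality)
    show "\<exists>V e. unitary V \<and> A = V ** real_diag e ** adj V \<and>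
        ?B = V ** real_diag (\<chi> i. f (e $ i)) ** adj V"
      using A by (auto simp: diagonalizes_def)
  qed (use unique in \<open>auto simp: diagonalizes_def\<close>)
  with A show ?thesis
    by (simp add: diagonalizes_def)
qed

lemma pos_def_diagonalizes:
  fixes A :: "complex^'n^'n"
  assumes "diagonalizes U d A"
  shows "pos_def A \<longleftrightarrow> (\<forall>i. 0 < d $ i)"
proof
  have U: "unitary U"
    using assms by (simp add: diagonalizes_def)
  have quad: "Re (\<Sum>i\<in>UNIV. cnj (x $ i) * (A *v x) $ i) =
      (\<Sum>i\<in>UNIV. d $ i * (cmod ((adj U *v x) $ i))\<^sup>2)" for x
    using cinner_diagonalizes [OF assms] by (simp add: cinner_def)
  show "\<forall>i. 0 < d $ i" if "pos_def A"
  proof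
    fix k
    have adjU: "adj U *v (U *v axis k 1) = axis k 1"
      using U by (simp add: matrix_vector_mul_assoc unitary_def)
    then have "U *v axis k 1 \<noteq> 0"
      by (metis axis_eq_0_iff matrix_vector_mult_0_right zero_neq_one)
    then have "0 < (\<Sum>i\<in>UNIV. d $ i * (cmod (axis k 1 $ i))\<^sup>2)"
      using that unfolding pos_def_def quad by (metis adjU)
    also have "\<dots> = (\<Sum>i\<in>UNIV. if i = k then d $ k else 0)"
      by (rule sum.cong) (auto simp: axis_def)
    finally show "0 < d $ k"
      by simp
  qed
  show "pos_def A" if pos: "\<forall>i. 0 < d $ i"
    unfolding pos_def_def quad
  proof (intro conjI allI impI)
    show "hermitian A"
      by (rule hermitian_diagonalizes [OF assms])
    fix x :: "complex^'n" assume "x \<noteq> 0"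
    have "norm (adj U *v x) = norm x"
      by (rule norm_unitary [OF unitary_adj [OF U]])
    with \<open>x \<noteq> 0\<close> have "adj U *v x \<noteq> 0"
      by auto
    then obtain k where "(adj U *v x) $ k \<noteq> 0"
      by (auto simp: vec_eq_iff)
    then show "0 < (\<Sum>i\<in>UNIV. d $ i * (cmod ((adj U *v x) $ i))\<^sup>2)"
      using pos by (intro sum_pos2 [of _ k]) (auto simp: less_imp_le)
  qed
qed

lemma pos_def_diagonalizable:
  assumes "pos_def A"
  obtains U d where "diagonalizes U d A" "\<And>i. 0 < d $ i"
  using assms hermitian_diagonalizable pos_def_diagonalizes pos_def_def by metis

lemma pos_def_convex_combination:
  fixes A B :: "complex^'n^'n"
  assumes "pos_def A" "pos_def B" "0 \<le> u" "0 \<le> v" "u + v = 1"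
  shows "pos_def (u *\<^sub>R A + v *\<^sub>R B)"
proof -
  have form: "Re (\<Sum>i\<in>UNIV. cnj (x $ i) * ((u *\<^sub>R A + v *\<^sub>R B) *v x) $ i) =
      u * Re (\<Sum>i\<in>UNIV. cnj (x $ i) * (A *v x) $ i) + v * Re (\<Sum>i\<in>UNIV. cnj (x $ i) * (B *v x) $ i)" for x
  proof -
    have "(u *\<^sub>R A + v *\<^sub>R B) *v x = u *\<^sub>R (A *v x) + v *\<^sub>R (B *v x)"
      by (simp add: vec_eq_iff matrix_vector_mult_def distrib_right sum.distrib scaleR_sum_right)
    then show ?thesis
      by (simp only: cinner_def [symmetric]) (simp add: cinner_add_right cinner_scaleR_right)
  qed
  show ?thesis
    unfolding pos_def_def form
  proof (intro conjI allI impI)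
    show "hermitian (u *\<^sub>R A + v *\<^sub>R B)"
      using assms by (simp add: pos_def_def hermitian_def)
    fix x :: "complex^'n" assume "x \<noteq> 0"
    then have "0 < Re (\<Sum>i\<in>UNIV. cnj (x $ i) * (A *v x) $ i)" (is "0 < ?a")
      and "0 < Re (\<Sum>i\<in>UNIV. cnj (x $ i) * (B *v x) $ i)" (is "0 < ?b")
      using assms by (simp_all add: pos_def_def)
    moreover have "u > 0 \<or> v > 0"
      using assms by linarith
    ultimately show "0 < u * ?a + v * ?b"
      using assms by (auto intro: add_pos_nonneg add_nonneg_pos)
  qed
qed

text \<open>Both products are values of polynomials, and equal polynomials have the same multiset of roots.\<close>

lemma roots_unique_up_to_permutation:
  fixes v d :: "real^'n"
  assumes "\<And>z::complex. (\<Prod>i\<in>UNIV. z - of_real (v $ i)) = (\<Prod>i\<in>UNIV. z - of_real (d $ i))"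
  obtains \<pi> where "\<pi> permutes UNIV" "v = (\<chi> i. d $ \<pi> i)"
proof -
  define P where "P = (\<lambda>v::real^'n. \<Prod>i\<in>UNIV. [:- complex_of_real (v $ i), 1:])"
  have "poly (P v) z = poly (P d) z" for z
    using assms [of z] by (simp add: P_def poly_prod)
  then have "P v = P d"
    by (simp add: poly_eq_poly_eq_iff [symmetric] fun_eq_iff)
  then have "proots (P v) = proots (P d)"
    by simp
  moreover have "proots (P w) = image_mset (\<lambda>i. complex_of_real (w $ i)) (mset_set UNIV)" for w
    unfolding P_def by (subst proots_prod) (auto simp: sum_unfold_sum_mset)
  ultimately have same: "image_mset (\<lambda>i. complex_of_real (v $ i)) (mset_set UNIV)
      = image_mset (\<lambda>i. complex_of_real (d $ i)) (mset_set UNIV)"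
    by simp
  obtain \<pi> where "\<pi> permutes UNIV" "\<forall>i\<in>UNIV. complex_of_real (v $ i) = complex_of_real (d $ \<pi> i)"
    by (rule image_mset_eq_implies_permutes [OF finite same])
  then show ?thesis
    using that by (simp add: vec_eq_iff)
qed

lemma spectral_extension_diagonalizes:
  assumes "symmetric_form \<phi>" and A: "diagonalizes U d A" and "\<And>i. 0 \<le> d $ i"
  shows "spectral_extension \<phi> A = \<phi> d"
proof -
  have char: "det (mat z - A) = (\<Prod>i\<in>UNIV. z - complex_of_real (d $ i))" for z
  proof -
    have UU: "U ** adj U = mat 1"
      using A by (simp add: diagonalizes_def unitary_def)
    have "mat z = U ** mat z ** adj U"
    proof -
      have "U ** mat z = mat z ** U"
        by (simp add: vec_eq_iff matrix_matrix_mult_def mat_def if_distrib if_distribR mult.commute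
            cong: if_cong)
      then show ?thesis
        using UU by (simp add: matrix_mul_assoc [symmetric])
    qed
    moreover have "U ** (B - C) ** adj U = U ** B ** adj U - U ** C ** adj U" for B C
      by (simp add: vec_eq_iff matrix_matrix_mult_def left_diff_distrib right_diff_distrib
          sum_subtractf)
    ultimately have "mat z - A = U ** (mat z - real_diag d) ** adj U"
      using A by (simp add: diagonalizes_def)
    then have "det (mat z - A) = det (U ** adj U) * det (mat z - real_diag d)"
      by (simp add: det_mul)
    also have "\<dots> = (\<Prod>i\<in>UNIV. (mat z - real_diag d) $ i $ i)"
      unfolding UU by (simp only: det_I mult_1) (rule det_diagonal, simp add: mat_def real_diag_def)
    finally show ?thesis
      by (simp add: mat_def real_diag_def)
  qed
  have "\<forall>z. det (mat z - A) = (\<Prod>i\<in>UNIV. z - complex_of_real (eigenvalue_vector A $ i))"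
    unfolding eigenvalue_vector_def by (rule someI [of _ d]) (simp add: char)
  then obtain \<pi> where "\<pi> permutes UNIV" "eigenvalue_vector A = (\<chi> i. d $ \<pi> i)"
    using roots_unique_up_to_permutation char by metis
  with assms show ?thesis
    by (simp add: spectral_extension_def symmetric_form_def nonneg_orthant_def)
qed

lemma diagonalizes_scaleR: "diagonalizes U a A \<Longrightarrow> diagonalizes U (c *\<^sub>R a) (c *\<^sub>R A)"
proof -
  have "real_diag (c *\<^sub>R a) = c *\<^sub>R real_diag a"
    by (simp add: vec_eq_iff real_diag_def) (simp add: scaleR_conv_of_real)
  then show "diagonalizes U a A \<Longrightarrow> ?thesis"
    by (simp add: diagonalizes_def scaleR_mult_left scaleR_mult_right)
qed

lemma hermitian_matrix_fun: "hermitian A \<Longrightarrow> hermitian (matrix_fun f A)"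
  by (metis hermitian_diagonalizable matrix_fun_diagonalizes hermitian_diagonalizes)

lemma diagonalizes_unique: "diagonalizes U d A \<Longrightarrow> diagonalizes U d B \<Longrightarrow> A = B"
  by (simp add: diagonalizes_def)

lemma matrix_log_exp:
  assumes "hermitian A"
  shows "matrix_log (matrix_exp A) = A"
proof -
  obtain U d where A: "diagonalizes U d A"
    using hermitian_diagonalizable assms by blast
  have "diagonalizes U (\<chi> i. ln ((\<chi> i. exp (d $ i)) $ i)) (matrix_log (matrix_exp A))"
    unfolding matrix_log_def matrix_exp_def by (intro matrix_fun_diagonalizes A)
  then have "diagonalizes U d (matrix_log (matrix_exp A))"
    by simp
  with A show ?thesis
    using diagonalizes_unique by blast
qed

lemma matrix_log_mat1: "matrix_log (mat 1 :: complex^'n^'n) = 0"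
proof -
  have "diagonalizes (mat 1) (\<chi> i. ln ((\<chi> i. 1) $ i)) (matrix_log (mat 1 :: complex^'n^'n))"
    unfolding matrix_log_def by (intro matrix_fun_diagonalizes diagonalizes_mat1 unitary_mat1)
  then have "diagonalizes (mat 1) (0 *\<^sub>R (\<chi> i. 1)) (matrix_log (mat 1 :: complex^'n^'n))"
    by (simp add: vec_eq_iff zero_vec_def)
  moreover have "diagonalizes (mat 1) (0 *\<^sub>R (\<chi> i. 1)) (0 *\<^sub>R (mat 1 :: complex^'n^'n))"
    by (intro diagonalizes_scaleR diagonalizes_mat1 unitary_mat1)
  ultimately show ?thesis
    using diagonalizes_unique by fastforce
qed

section \<open>Joint convexity of the relative entropy\<close>

definition overlap :: "complex^'n^'n \<Rightarrow> complex^'n^'n \<Rightarrow> 'n \<Rightarrow> 'n \<Rightarrow> real" where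
  "overlap U V i j = (cmod ((adj U ** V) $ i $ j))\<^sup>2"

lemma overlap_nonneg [simp]: "0 \<le> overlap U V i j"
  by (simp add: overlap_def)

lemma overlap_sums:
  assumes "unitary U" "unitary V"
  shows "(\<Sum>j\<in>UNIV. overlap U V i j) = 1" "(\<Sum>i\<in>UNIV. overlap U V i j) = 1"
  unfolding overlap_def
  by (intro unitary_row_sum unitary_column_sum unitary_mult unitary_adj assms)+

text \<open>Since the overlaps are doubly stochastic, traces of functions of a single matrix can be compared
  term by term with the double sums that come from two matrices.\<close>

lemma overlap_expand:
  assumes "unitary U" "unitary V"
  shows "(\<Sum>i\<in>UNIV. f i) = (\<Sum>i\<in>UNIV. \<Sum>j\<in>UNIV. overlap U V i j * f i)"
    and "(\<Sum>j\<in>UNIV. f j) = (\<Sum>i\<in>UNIV. \<Sum>j\<in>UNIV. overlap U V i j * f j)"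
proof -
  show "(\<Sum>i\<in>UNIV. f i) = (\<Sum>i\<in>UNIV. \<Sum>j\<in>UNIV. overlap U V i j * f i)"
    using overlap_sums [OF assms] by (simp flip: sum_distrib_right)
  have "(\<Sum>j\<in>UNIV. f j) = (\<Sum>j\<in>UNIV. \<Sum>i\<in>UNIV. overlap U V i j * f j)"
    using overlap_sums [OF assms] by (simp flip: sum_distrib_right)
  also have "\<dots> = (\<Sum>i\<in>UNIV. \<Sum>j\<in>UNIV. overlap U V i j * f j)"
    by (rule sum.swap)
  finally show "(\<Sum>j\<in>UNIV. f j) = (\<Sum>i\<in>UNIV. \<Sum>j\<in>UNIV. overlap U V i j * f j)" .
qed

text \<open>This is the trace against the identity of the parallel sum \<open>L\<^sub>X R\<^sub>A (L\<^sub>X + R\<^sub>A)\<^sup>-\<^sup>1\<close> of left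
  multiplication by \<open>X\<close> and right multiplication by \<open>A\<close>, written in eigenbases \<open>U\<close> of \<open>X\<close> and \<open>V\<close>
  of \<open>A\<close>.\<close>

definition parallel_form ::
    "complex^'n^'n \<Rightarrow> real^'n \<Rightarrow> complex^'n^'n \<Rightarrow> real^'n \<Rightarrow> real" where
  "parallel_form U x V a =
    (\<Sum>i\<in>UNIV. \<Sum>j\<in>UNIV. overlap U V i j * (x $ i * a $ j / (x $ i + a $ j)))"

text \<open>Two resistors in parallel: after \<open>\<bar>w\<bar> \<le> \<bar>z\<bar> + \<bar>w - z\<bar>\<close>, the difference of the two sides is the
  square of \<open>x \<bar>z\<bar> - a \<bar>w - z\<bar>\<close> up to a positive factor.\<close>

lemma scalar_parallel_le:
  fixes x a :: real and w z :: complex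
  assumes "x > 0" "a > 0"
  shows "(cmod w)\<^sup>2 * (x * a / (x + a)) \<le> x * (cmod z)\<^sup>2 + a * (cmod (w - z))\<^sup>2"
proof -
  let ?p = "cmod z" and ?q = "cmod (w - z)"
  have "cmod w \<le> ?p + ?q"
    using norm_triangle_ineq [of z "w - z"] by simp
  then have "(cmod w)\<^sup>2 \<le> (?p + ?q)\<^sup>2"
    by (intro power_mono) auto
  then have "(cmod w)\<^sup>2 * (x * a) \<le> (?p + ?q)\<^sup>2 * (x * a)"
    using assms by (intro mult_right_mono) auto
  also have "\<dots> \<le> (?p + ?q)\<^sup>2 * (x * a) + (x * ?p - a * ?q)\<^sup>2"
    by simp
  also have "\<dots> = (x * ?p\<^sup>2 + a * ?q\<^sup>2) * (x + a)"
    by (simp add: power2_eq_square algebra_simps)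
  finally show ?thesis
    using assms by (simp add: divide_simps)
qed

text \<open>In the coordinates \<open>U\<^sup>* Z V\<close> the right-hand side decouples into one scalar problem for each entry,
  with \<open>w\<close> an entry of \<open>U\<^sup>* V\<close>.\<close>

lemma parallel_form_le:
  assumes X: "diagonalizes U x X" "\<And>i. x $ i > 0" and A: "diagonalizes V a A" "\<And>j. a $ j > 0"
  shows "parallel_form U x V a \<le>
    re_trace (adj Z ** X ** Z) + re_trace ((mat 1 - Z) ** A ** adj (mat 1 - Z))"
proof -
  have UV: "unitary U" "unitary V"
    using X A by (simp_all add: diagonalizes_def)
  let ?W = "adj U ** V" and ?Y = "adj U ** Z ** V"
  have diff: "adj U ** (mat 1 - Z) ** V = ?W - ?Y"
  proof -
    have "adj U ** (mat 1 - Z) ** V = adj U ** (mat 1 + (-1) *\<^sub>R Z) ** V"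
      by simp
    then show ?thesis
      by (simp only: matrix_add_ldistrib mult_add_left scaleR_mult_left scaleR_mult_right) simp
  qed
  have "parallel_form U x V a \<le> (\<Sum>i\<in>UNIV. \<Sum>j\<in>UNIV.
      x $ i * (cmod (?Y $ i $ j))\<^sup>2 + a $ j * (cmod (?W $ i $ j - ?Y $ i $ j))\<^sup>2)"
    unfolding parallel_form_def overlap_def
    by (intro sum_mono scalar_parallel_le X A)
  then show ?thesis
    by (simp add: re_trace_sandwich_left [OF X(1) UV(2)] re_trace_sandwich_right [OF A(1) UV(1)]
        diff sum.distrib)
qed

text \<open>The scalar minimizers \<open>z = a / (x + a) w\<close> of the entries assemble to a matrix \<open>Z\<close>.\<close>

lemma parallel_form_attained:
  assumes X: "diagonalizes U x X" "\<And>i. x $ i > 0" and A: "diagonalizes V a A" "\<And>j. a $ j > 0"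
  obtains Z where "parallel_form U x V a =
    re_trace (adj Z ** X ** Z) + re_trace ((mat 1 - Z) ** A ** adj (mat 1 - Z))"
proof -
  have UV: "unitary U" "unitary V"
    using X A by (simp_all add: diagonalizes_def)
  let ?W = "adj U ** V"
  define Y where "Y = (\<chi> i j. of_real (a $ j / (x $ i + a $ j)) * ?W $ i $ j)"
  define Z where "Z = U ** Y ** adj V"
  have Z: "adj U ** Z ** V = Y"
    using UV by (simp add: Z_def unitary_cancel flip: matrix_mul_assoc)
      (simp add: unitary_def)
  have diff: "adj U ** (mat 1 - Z) ** V = ?W - Y"
  proof -
    have "adj U ** (mat 1 - Z) ** V = adj U ** (mat 1 + (-1) *\<^sub>R Z) ** V"
      by simp
    then show ?thesis
      by (simp only: matrix_add_ldistrib mult_add_left scaleR_mult_left scaleR_mult_right Z) simp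
  qed
  have scaled: "(cmod (of_real r * w))\<^sup>2 = r\<^sup>2 * (cmod w)\<^sup>2" for r w
    by (simp add: norm_mult power_mult_distrib)
  have pointwise: "overlap U V i j * (x $ i * a $ j / (x $ i + a $ j)) =
      x $ i * (cmod (Y $ i $ j))\<^sup>2 + a $ j * (cmod (?W $ i $ j - Y $ i $ j))\<^sup>2" for i j
  proof -
    let ?s = "x $ i + a $ j"
    have s: "?s > 0"
      using X(2) A(2) by (simp add: add_pos_pos)
    have "?W $ i $ j - Y $ i $ j = of_real (1 - a $ j / ?s) * ?W $ i $ j"
      by (simp add: Y_def algebra_simps)
    also have "1 - a $ j / ?s = x $ i / ?s"
      using s by (simp add: field_simps)
    finally have "(cmod (?W $ i $ j - Y $ i $ j))\<^sup>2 = (x $ i / ?s)\<^sup>2 * overlap U V i j"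
      by (simp only: scaled overlap_def)
    moreover have "(cmod (Y $ i $ j))\<^sup>2 = (a $ j / ?s)\<^sup>2 * overlap U V i j"
      by (simp only: Y_def vec_lambda_beta scaled overlap_def)
    moreover have "x $ i * a $ j / ?s = x $ i * (a $ j / ?s)\<^sup>2 + a $ j * (x $ i / ?s)\<^sup>2"
      using s by (simp add: divide_simps) (simp add: power2_eq_square algebra_simps)
    ultimately show ?thesis
      by (simp add: algebra_simps)
  qed
  have "parallel_form U x V a =
      re_trace (adj Z ** X ** Z) + re_trace ((mat 1 - Z) ** A ** adj (mat 1 - Z))"
    unfolding parallel_form_def pointwise re_trace_sandwich_left [OF X(1) UV(2)]
      re_trace_sandwich_right [OF A(1) UV(1)] diff Z
    by (simp add: sum.distrib)
  then show ?thesis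
    by (rule that)
qed

text \<open>A minimum over \<open>Z\<close> of functions that are linear in \<open>(X, A)\<close> is concave: the minimizer for the
  combined pair is a competitor for each of the two given pairs.\<close>

lemma parallel_form_concave:
  assumes 1: "diagonalizes U1 x1 X1" "\<And>i. x1 $ i > 0" "diagonalizes V1 a1 A1" "\<And>j. a1 $ j > 0"
    and 2: "diagonalizes U2 x2 X2" "\<And>i. x2 $ i > 0" "diagonalizes V2 a2 A2" "\<And>j. a2 $ j > 0"
    and 3: "diagonalizes U3 x3 (u *\<^sub>R X1 + v *\<^sub>R X2)" "\<And>i. x3 $ i > 0"
      "diagonalizes V3 a3 (u *\<^sub>R A1 + v *\<^sub>R A2)" "\<And>j. a3 $ j > 0"
    and uv: "0 \<le> u" "0 \<le> v"
  shows "u * parallel_form U1 x1 V1 a1 + v * parallel_form U2 x2 V2 a2 \<le> parallel_form U3 x3 V3 a3"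
proof -
  obtain Z where Z: "parallel_form U3 x3 V3 a3 =
      re_trace (adj Z ** (u *\<^sub>R X1 + v *\<^sub>R X2) ** Z) +
      re_trace ((mat 1 - Z) ** (u *\<^sub>R A1 + v *\<^sub>R A2) ** adj (mat 1 - Z))"
    using parallel_form_attained [OF 3] by blast
  define q where "q = (\<lambda>X A. re_trace (adj Z ** X ** Z) +
      re_trace ((mat 1 - Z) ** A ** adj (mat 1 - Z)))"
  have "u * parallel_form U1 x1 V1 a1 + v * parallel_form U2 x2 V2 a2 \<le> u * q X1 A1 + v * q X2 A2"
    unfolding q_def by (intro add_mono mult_left_mono parallel_form_le 1 2 uv)
  also have "\<dots> = parallel_form U3 x3 V3 a3"
    unfolding Z q_def
    by (simp only: matrix_add_ldistrib mult_add_left scaleR_mult_left scaleR_mult_right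
        re_trace_add re_trace_scaleR) (simp add: algebra_simps)
  finally show ?thesis .
qed

definition rel_entropy :: "complex^'n^'n \<Rightarrow> complex^'n^'n \<Rightarrow> real" where
  "rel_entropy X A = re_trace (X ** matrix_log X) - re_trace (X ** matrix_log A)"

text \<open>The path joins \<open>0\<close> at \<open>t = 0\<close> to the relative entropy at \<open>t = 1\<close>; its derivative is minus a
  parallel sum, up to positive factors and a linear term.\<close>

definition entropy_path ::
    "complex^'n^'n \<Rightarrow> real^'n \<Rightarrow> complex^'n^'n \<Rightarrow> real^'n \<Rightarrow> real \<Rightarrow> real" where
  "entropy_path U x V a t = (\<Sum>i\<in>UNIV. \<Sum>j\<in>UNIV.
    overlap U V i j * (x $ i * (ln (x $ i) - ln ((1 - t) * x $ i + t * a $ j))))"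

lemma re_trace_mult_same_basis:
  fixes U :: "complex^'n^'n"
  assumes "diagonalizes U x X" "diagonalizes U a A"
  shows "re_trace (X ** A) = (\<Sum>i\<in>UNIV. x $ i * a $ i)"
proof -
  have "adj U ** U = mat 1"
    using assms by (simp add: diagonalizes_def unitary_def)
  then have "re_trace (X ** A) =
      (\<Sum>i\<in>UNIV. \<Sum>j\<in>UNIV. (cmod ((mat 1 :: complex^'n^'n) $ i $ j))\<^sup>2 * (x $ i * a $ j))"
    by (simp add: re_trace_mult_diagonalizes [OF assms])
  also have "\<dots> = (\<Sum>i\<in>UNIV. \<Sum>j\<in>UNIV. if i = j then x $ i * a $ i else 0)"
    by (intro sum.cong) (auto simp: mat_def)
  finally show ?thesis
    by simp
qed

lemma rel_entropy_diagonalizes: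
  assumes X: "diagonalizes U x X" and A: "diagonalizes V a A"
  shows "rel_entropy X A = entropy_path U x V a 1"
proof -
  have UV: "unitary U" "unitary V"
    using X A by (simp_all add: diagonalizes_def)
  have "re_trace (X ** matrix_log X) = (\<Sum>i\<in>UNIV. x $ i * ln (x $ i))"
    using re_trace_mult_same_basis [OF X matrix_fun_diagonalizes [OF X, of ln]]
    by (simp add: matrix_log_def)
  also have "\<dots> = (\<Sum>i\<in>UNIV. \<Sum>j\<in>UNIV. overlap U V i j * (x $ i * ln (x $ i)))"
    by (rule overlap_expand [OF UV])
  finally have "re_trace (X ** matrix_log X) = \<dots>" .
  moreover have "re_trace (X ** matrix_log A) =
      (\<Sum>i\<in>UNIV. \<Sum>j\<in>UNIV. overlap U V i j * (x $ i * ln (a $ j)))"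
    using re_trace_mult_diagonalizes [OF X matrix_fun_diagonalizes [OF A, of ln]]
    by (simp add: matrix_log_def overlap_def)
  ultimately show ?thesis
    by (simp add: rel_entropy_def entropy_path_def sum_subtractf right_diff_distrib)
qed

lemma entropy_path_0 [simp]: "entropy_path U x V a 0 = 0"
  by (simp add: entropy_path_def)

lemma convex_comb_pos: "0 < (1 - t) * x + t * a" if "0 < x" "0 < a" "0 \<le> t" "t \<le> 1" for x a t :: real
proof (cases "t = 1")
  case False
  with that show ?thesis
    by (intro add_pos_nonneg mult_pos_pos mult_nonneg_nonneg) auto
qed (use that in simp)

lemma continuous_entropy_path:
  assumes "\<And>i. x $ i > 0" "\<And>j. a $ j > 0"
  shows "continuous_on {0..1} (entropy_path U x V a)"
proof -
  have "(1 - t) * x $ i + t * a $ j \<noteq> 0" if "t \<in> {0..1}" for t i j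
    using convex_comb_pos [OF assms, of t i j] that by simp
  then show ?thesis
    unfolding entropy_path_def by (intro continuous_intros) auto
qed

text \<open>With \<open>m = (1 - t) x + t a\<close> each term has derivative \<open>x (x - a) / m\<close>, and
  \<open>x (x - a) / m = (x - x a / m) / (1 - t)\<close>; the parallel sum of \<open>(1 - t) x\<close> and \<open>t a\<close> is
  \<open>t (1 - t) x a / m\<close>.\<close>

lemma entropy_path_deriv:
  assumes X: "diagonalizes U x X" "\<And>i. x $ i > 0" and A: "diagonalizes V a A" "\<And>j. a $ j > 0"
    and t: "0 < t" "t < 1"
  shows "(entropy_path U x V a has_real_derivative
    (re_trace X - parallel_form U ((1 - t) *\<^sub>R x) V (t *\<^sub>R a) / (t * (1 - t))) / (1 - t)) (at t)"
proof -
  have UV: "unitary U" "unitary V"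
    using X A by (simp_all add: diagonalizes_def)
  let ?m = "\<lambda>i j. (1 - t) * x $ i + t * a $ j"
  have m: "?m i j > 0" for i j
    using convex_comb_pos [OF X(2) A(2), of t i j] t by simp
  have deriv: "((\<lambda>t. x $ i * (ln (x $ i) - ln ((1 - t) * x $ i + t * a $ j))) has_real_derivative
      x $ i * (x $ i - a $ j) / ?m i j) (at t)" for i j
  proof -
    have "((\<lambda>t. (1 - t) * x $ i + t * a $ j) has_real_derivative a $ j - x $ i) (at t)"
      by (auto intro!: derivative_eq_intros)
    from DERIV_cmult [OF DERIV_diff [OF DERIV_const DERIV_chain2 [OF DERIV_ln_divide [OF m] this]]]
    show ?thesis
      by (rule DERIV_cong) (simp add: diff_divide_distrib right_diff_distrib algebra_simps)
  qed
  have "(entropy_path U x V a has_real_derivative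
      (\<Sum>i\<in>UNIV. \<Sum>j\<in>UNIV. overlap U V i j * (x $ i * (x $ i - a $ j) / ?m i j))) (at t)"
    unfolding entropy_path_def
    by (intro DERIV_sum DERIV_cmult deriv)
  moreover have "(\<Sum>i\<in>UNIV. \<Sum>j\<in>UNIV. overlap U V i j * (x $ i * (x $ i - a $ j) / ?m i j)) =
      (re_trace X - parallel_form U ((1 - t) *\<^sub>R x) V (t *\<^sub>R a) / (t * (1 - t))) / (1 - t)"
  proof -
    have "x $ i * (x $ i - a $ j) / ?m i j =
        (x $ i - ((1 - t) * x $ i) * (t * a $ j) / ?m i j / (t * (1 - t))) / (1 - t)" for i j
      using t m [of i j] by (simp add: divide_simps) (simp add: algebra_simps)
    moreover have "re_trace X = (\<Sum>i\<in>UNIV. \<Sum>j\<in>UNIV. overlap U V i j * x $ i)"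
      unfolding re_trace_diagonalizes [OF X(1)] by (rule overlap_expand [OF UV])
    ultimately show ?thesis
      by (simp add: parallel_form_def right_diff_distrib diff_divide_distrib sum_subtractf
          sum_divide_distrib)
  qed
  ultimately show ?thesis
    by simp
qed

text \<open>The convexity defect along the entropy paths starts at \<open>0\<close>. Its derivative is nonnegative, since the
  traces cancel and the parallel sums enter with a negative sign.\<close>

theorem rel_entropy_jointly_convex:
  fixes X1 X2 A1 A2 :: "complex^'n^'n"
  assumes "pos_def X1" "pos_def X2" "pos_def A1" "pos_def A2"
    and uv: "0 \<le> u" "0 \<le> v" "u + v = 1"
  shows "rel_entropy (u *\<^sub>R X1 + v *\<^sub>R X2) (u *\<^sub>R A1 + v *\<^sub>R A2) \<le>
    u * rel_entropy X1 A1 + v * rel_entropy X2 A2"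
proof -
  let ?X3 = "u *\<^sub>R X1 + v *\<^sub>R X2" and ?A3 = "u *\<^sub>R A1 + v *\<^sub>R A2"
  have "pos_def ?X3" "pos_def ?A3"
    using assms by (simp_all add: pos_def_convex_combination)
  obtain U1 x1 where X1: "diagonalizes U1 x1 X1" "\<And>i. 0 < x1 $ i"
    using pos_def_diagonalizable assms by metis
  obtain U2 x2 where X2: "diagonalizes U2 x2 X2" "\<And>i. 0 < x2 $ i"
    using pos_def_diagonalizable assms by metis
  obtain U3 x3 where X3: "diagonalizes U3 x3 ?X3" "\<And>i. 0 < x3 $ i"
    using pos_def_diagonalizable \<open>pos_def ?X3\<close> by metis
  obtain V1 a1 where A1: "diagonalizes V1 a1 A1" "\<And>i. 0 < a1 $ i"
    using pos_def_diagonalizable assms by metis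
  obtain V2 a2 where A2: "diagonalizes V2 a2 A2" "\<And>i. 0 < a2 $ i"
    using pos_def_diagonalizable assms by metis
  obtain V3 a3 where A3: "diagonalizes V3 a3 ?A3" "\<And>i. 0 < a3 $ i"
    using pos_def_diagonalizable \<open>pos_def ?A3\<close> by metis
  define gap where "gap = (\<lambda>t. u * entropy_path U1 x1 V1 a1 t + v * entropy_path U2 x2 V2 a2 t
      - entropy_path U3 x3 V3 a3 t)"
  have "gap 0 \<le> gap 1"
  proof (rule DERIV_nonneg_imp_increasing_open [where f = gap])
    fix t :: real assume t: "0 < t" "t < 1"
    let ?P1 = "parallel_form U1 ((1 - t) *\<^sub>R x1) V1 (t *\<^sub>R a1)"
      and ?P2 = "parallel_form U2 ((1 - t) *\<^sub>R x2) V2 (t *\<^sub>R a2)"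
      and ?P3 = "parallel_form U3 ((1 - t) *\<^sub>R x3) V3 (t *\<^sub>R a3)"
    let ?D = "u * ((re_trace X1 - ?P1 / (t * (1 - t))) / (1 - t)) +
        v * ((re_trace X2 - ?P2 / (t * (1 - t))) / (1 - t)) -
        (re_trace ?X3 - ?P3 / (t * (1 - t))) / (1 - t)"
    have "(gap has_real_derivative ?D) (at t)"
      unfolding gap_def
      by (intro DERIV_diff DERIV_add DERIV_cmult entropy_path_deriv [OF X1 A1 t]
          entropy_path_deriv [OF X2 A2 t] entropy_path_deriv [OF X3 A3 t])
    moreover have "?D \<ge> 0"
    proof -
      have "u * ?P1 + v * ?P2 \<le> ?P3"
      proof (rule parallel_form_concave)
        show "diagonalizes U1 ((1 - t) *\<^sub>R x1) ((1 - t) *\<^sub>R X1)"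
          "diagonalizes U2 ((1 - t) *\<^sub>R x2) ((1 - t) *\<^sub>R X2)"
          "diagonalizes V1 (t *\<^sub>R a1) (t *\<^sub>R A1)" "diagonalizes V2 (t *\<^sub>R a2) (t *\<^sub>R A2)"
          by (intro diagonalizes_scaleR X1 X2 A1 A2)+
        show "diagonalizes U3 ((1 - t) *\<^sub>R x3) (u *\<^sub>R (1 - t) *\<^sub>R X1 + v *\<^sub>R (1 - t) *\<^sub>R X2)"
          using diagonalizes_scaleR [OF X3(1), of "1 - t"]
          by (simp only: scaleR_add_right scaleR_scaleR mult.commute)
        show "diagonalizes V3 (t *\<^sub>R a3) (u *\<^sub>R t *\<^sub>R A1 + v *\<^sub>R t *\<^sub>R A2)"
          using diagonalizes_scaleR [OF A3(1), of t]
          by (simp only: scaleR_add_right scaleR_scaleR mult.commute)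
      qed (use t uv X1 X2 X3 A1 A2 A3 in auto)
      moreover have "?D = (?P3 - (u * ?P1 + v * ?P2)) / (t * (1 - t)) / (1 - t)"
        by (simp add: re_trace_add re_trace_scaleR diff_divide_distrib add_divide_distrib
            right_diff_distrib)
      ultimately show ?thesis
        using t by simp
    qed
    ultimately show "\<exists>y. (gap has_real_derivative y) (at t) \<and> 0 \<le> y"
      by blast
  next
    show "continuous_on {0..1} gap"
      unfolding gap_def
      by (intro continuous_intros continuous_entropy_path X1 X2 X3 A1 A2 A3)
  qed simp
  then show ?thesis
    using rel_entropy_diagonalizes [OF X1(1) A1(1)] rel_entropy_diagonalizes [OF X2(1) A2(1)]
      rel_entropy_diagonalizes [OF X3(1) A3(1)]
    by (simp add: gap_def)
qed

section \<open>Lieb's concavity theorem\<close>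

text \<open>In eigenbases this is the tangent line inequality \<open>exp l \<ge> x + x (l - ln x)\<close>, averaged over the
  overlaps of the two bases.\<close>

lemma gibbs_inequality:
  assumes "hermitian L" "pos_def X"
  shows "re_trace (X ** L) - re_trace (X ** matrix_log X) + re_trace X \<le> re_trace (matrix_exp L)"
proof -
  obtain V l where L: "diagonalizes V l L"
    using hermitian_diagonalizable assms by blast
  obtain U x where X: "diagonalizes U x X" "\<And>i. 0 < x $ i"
    using pos_def_diagonalizable assms by metis
  have UV: "unitary U" "unitary V"
    using X L by (simp_all add: diagonalizes_def)
  have scalar: "x $ i * l $ j - x $ i * ln (x $ i) + x $ i \<le> exp (l $ j)" for i j
  proof -
    have "x $ i * (1 + (l $ j - ln (x $ i))) \<le> x $ i * exp (l $ j - ln (x $ i))"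
      using X(2) by (intro mult_left_mono exp_ge_add_one_self) (simp add: less_imp_le)
    also have "\<dots> = exp (l $ j)"
      using X(2) [of i] by (simp add: exp_diff)
    finally show ?thesis
      by (simp add: algebra_simps)
  qed
  have "re_trace (X ** L) - re_trace (X ** matrix_log X) + re_trace X =
      (\<Sum>i\<in>UNIV. \<Sum>j\<in>UNIV. overlap U V i j * (x $ i * l $ j - x $ i * ln (x $ i) + x $ i))"
  proof -
    have "re_trace (X ** matrix_log X) = (\<Sum>i\<in>UNIV. x $ i * ln (x $ i))"
      using re_trace_mult_same_basis [OF X(1) matrix_fun_diagonalizes [OF X(1), of ln]]
      by (simp add: matrix_log_def)
    then have "re_trace (X ** matrix_log X) =
        (\<Sum>i\<in>UNIV. \<Sum>j\<in>UNIV. overlap U V i j * (x $ i * ln (x $ i)))"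
      using overlap_expand(1) [OF UV] by metis
    moreover have "re_trace X = (\<Sum>i\<in>UNIV. \<Sum>j\<in>UNIV. overlap U V i j * x $ i)"
      unfolding re_trace_diagonalizes [OF X(1)] by (rule overlap_expand [OF UV])
    moreover have "re_trace (X ** L) = (\<Sum>i\<in>UNIV. \<Sum>j\<in>UNIV. overlap U V i j * (x $ i * l $ j))"
      unfolding overlap_def by (rule re_trace_mult_diagonalizes [OF X(1) L])
    ultimately show ?thesis
      by (simp add: sum.distrib sum_subtractf distrib_left right_diff_distrib)
  qed
  also have "\<dots> \<le> (\<Sum>i\<in>UNIV. \<Sum>j\<in>UNIV. overlap U V i j * exp (l $ j))"
    by (intro sum_mono mult_left_mono scalar) simp
  also have "\<dots> = (\<Sum>j\<in>UNIV. exp (l $ j))"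
    by (rule overlap_expand(2) [OF UV, symmetric])
  also have "\<dots> = re_trace (matrix_exp L)"
    using re_trace_diagonalizes [OF matrix_fun_diagonalizes [OF L, of exp]]
    by (simp add: matrix_exp_def)
  finally show ?thesis .
qed

lemma pos_def_matrix_exp: "hermitian L \<Longrightarrow> pos_def (matrix_exp L)"
proof -
  assume "hermitian L"
  then obtain V l where L: "diagonalizes V l L"
    using hermitian_diagonalizable by blast
  show ?thesis
    using pos_def_diagonalizes [OF matrix_fun_diagonalizes [OF L, of exp]]
    by (simp add: matrix_exp_def)
qed

definition log_sum :: "complex^'n^'n \<Rightarrow> ('m::finite \<Rightarrow> real) \<Rightarrow> ('m \<Rightarrow> complex^'n^'n) \<Rightarrow> complex^'n^'n" where
  "log_sum H p A = H + (\<Sum>j\<in>UNIV. p j *\<^sub>R matrix_log (A j))"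

lemma hermitian_log_sum:
  assumes "hermitian H" "\<And>j. pos_def (A j)"
  shows "hermitian (log_sum H p A)"
proof -
  have "hermitian (matrix_log (A j))" for j
    using assms(2) by (simp add: matrix_log_def hermitian_matrix_fun pos_def_def)
  with assms(1) show ?thesis
    by (simp add: log_sum_def hermitian_def)
qed

text \<open>The weight \<open>1 - \<Sum>\<^sub>j p\<^sub>j\<close> that the matrices \<open>A\<^sub>j\<close> leave over goes to the identity, whose logarithm
  vanishes; \<open>tr X log X\<close> is thereby absorbed into relative entropies.\<close>

lemma gibbs_functional_rel_entropy:
  "re_trace (X ** log_sum H p A) - re_trace (X ** matrix_log X) + re_trace X =
    re_trace (X ** H) + re_trace X - (\<Sum>j\<in>UNIV. p j * rel_entropy X (A j))
      - (1 - (\<Sum>j\<in>UNIV. p j)) * rel_entropy X (mat 1)"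
proof -
  have "rel_entropy X (mat 1) = re_trace (X ** matrix_log X)"
    by (simp add: rel_entropy_def matrix_log_mat1 re_trace_def trace_def matrix_matrix_mult_def)
  then show ?thesis
    unfolding log_sum_def
    by (simp only: re_trace_linear)
      (simp add: rel_entropy_def right_diff_distrib sum_subtractf sum_distrib_right algebra_simps)
qed

text \<open>The maximizers for \<open>A\<close> and \<open>B\<close> are combined to a trial matrix for the combination of \<open>A\<close> and \<open>B\<close>.\<close>

theorem lieb_concavity:
  fixes p :: "'m::finite \<Rightarrow> real" and H :: "complex^'n^'n"
  assumes H: "hermitian H" and p: "\<And>j. 0 \<le> p j" "(\<Sum>j\<in>UNIV. p j) \<le> 1"
    and A: "\<And>j. pos_def (A j)" and B: "\<And>j. pos_def (B j)"
    and uv: "0 \<le> u" "0 \<le> v" "u + v = 1"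
  shows "u * re_trace (matrix_exp (log_sum H p A)) + v * re_trace (matrix_exp (log_sum H p B)) \<le>
    re_trace (matrix_exp (log_sum H p (\<lambda>j. u *\<^sub>R A j + v *\<^sub>R B j)))"
proof -
  let ?C = "\<lambda>j. u *\<^sub>R A j + v *\<^sub>R B j"
  define X where "X = matrix_exp (log_sum H p A)"
  define Y where "Y = matrix_exp (log_sum H p B)"
  let ?Z = "u *\<^sub>R X + v *\<^sub>R Y"
  define q where "q = (\<lambda>X A. re_trace (X ** log_sum H p A) - re_trace (X ** matrix_log X) + re_trace X)"
  have XY: "pos_def X" "pos_def Y"
    unfolding X_def Y_def by (intro pos_def_matrix_exp hermitian_log_sum H A B)+
  \<comment> \<open>At \<open>X = exp L\<close> the terms \<open>tr X L\<close> and \<open>tr X log X\<close> cancel.\<close>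
  have "q X A = re_trace X" "q Y B = re_trace Y"
    unfolding q_def X_def Y_def
    by (simp_all add: matrix_log_exp hermitian_log_sum H A B)
  moreover have "u * q X A + v * q Y B \<le> q ?Z ?C"
  proof -
    have D: "rel_entropy ?Z (?C j) \<le> u * rel_entropy X (A j) + v * rel_entropy Y (B j)" for j
      by (intro rel_entropy_jointly_convex XY A B uv)
    have one: "pos_def (mat 1 :: complex^'n^'n)"
      using pos_def_diagonalizes [OF diagonalizes_mat1 [OF unitary_mat1]] by simp
    have "u *\<^sub>R mat 1 + v *\<^sub>R mat 1 = (mat 1 :: complex^'n^'n)"
      using uv(3) by (simp flip: scaleR_add_left)
    then have D1: "rel_entropy ?Z (mat 1) \<le> u * rel_entropy X (mat 1) + v * rel_entropy Y (mat 1)"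
      using rel_entropy_jointly_convex [OF XY one one uv] by simp
    have "(\<Sum>j\<in>UNIV. p j * rel_entropy ?Z (?C j)) \<le>
        (\<Sum>j\<in>UNIV. p j * (u * rel_entropy X (A j) + v * rel_entropy Y (B j)))"
      by (intro sum_mono mult_left_mono D p)
    moreover have "(1 - (\<Sum>j\<in>UNIV. p j)) * rel_entropy ?Z (mat 1) \<le>
        (1 - (\<Sum>j\<in>UNIV. p j)) * (u * rel_entropy X (mat 1) + v * rel_entropy Y (mat 1))"
      using p(2) by (intro mult_left_mono D1) simp
    ultimately show ?thesis
      unfolding q_def gibbs_functional_rel_entropy
      by (simp add: mult_add_left scaleR_mult_left re_trace_add re_trace_scaleR
          distrib_left sum.distrib sum_distrib_left algebra_simps)
  qed
  moreover have "q ?Z ?C \<le> re_trace (matrix_exp (log_sum H p ?C))"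
    unfolding q_def
    by (intro gibbs_inequality hermitian_log_sum pos_def_convex_combination H A B XY uv)
  ultimately show ?thesis
    by (simp add: X_def Y_def)
qed

section \<open>Partial sums of the smallest eigenvalues\<close>

text \<open>The eigenvectors of \<open>L = K + Y\<close> with index outside \<open>I2\<close> span a space of dimension \<open>n - card I2\<close>.
  Being annihilated by \<open>Y\<close> and orthogonal to the eigenvectors of \<open>K\<close> with index in \<open>I1\<close> amounts to
  at most \<open>card J + card I1\<close> linear conditions, so some \<open>x \<noteq> 0\<close> in that space satisfies them all. Its
  quadratic form is the same for \<open>K\<close> and \<open>L\<close>, at least \<open>a \<bar>x\<bar>\<^sup>2\<close> and at most \<open>b \<bar>x\<bar>\<^sup>2\<close>.\<close>

lemma eigenvalue_interlacing:
  fixes K Y :: "complex^'n^'n"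
  assumes K: "diagonalizes V \<kappa> K" and Y: "diagonalizes W y Y" and L: "diagonalizes U l (K + Y)"
    and J: "\<And>j. j \<notin> J \<Longrightarrow> y $ j = 0"
    and card: "card J + card I1 + card I2 < CARD('n)"
    and kI: "\<And>j. j \<notin> I1 \<Longrightarrow> a \<le> \<kappa> $ j" and lI: "\<And>j. j \<notin> I2 \<Longrightarrow> l $ j \<le> b"
  shows "a \<le> b"
proof -
  define r where "r = (\<lambda>(M :: complex^'n^'n) j. adj M $ j)"
  define R where "R = r W ` J \<union> r V ` I1 \<union> r U ` I2"
  have "card R \<le> card (r W ` J) + card (r V ` I1) + card (r U ` I2)"
    unfolding R_def by (intro order_trans [OF card_Un_le] add_mono card_Un_le order_refl)
  also have "\<dots> \<le> card J + card I1 + card I2"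
    by (intro add_mono card_image_le) simp_all
  finally have few: "card R < CARD('n)"
    using card by linarith
  obtain x where x: "x \<noteq> 0" "\<And>s. s \<in> R \<Longrightarrow> (\<Sum>i\<in>UNIV. s $ i * x $ i) = 0"
    by (rule exists_nonzero_annihilated [OF _ few]) (auto simp: R_def)
  have "(adj M *v x) $ j = (\<Sum>i\<in>UNIV. r M j $ i * x $ i)" for M j
    by (simp add: matrix_vector_mult_def r_def)
  then have zero: "j \<in> J \<Longrightarrow> (adj W *v x) $ j = 0" "j \<in> I1 \<Longrightarrow> (adj V *v x) $ j = 0"
      "j \<in> I2 \<Longrightarrow> (adj U *v x) $ j = 0" for j
    using x(2) by (auto simp: R_def)
  have norms: "(\<Sum>j\<in>UNIV. (cmod ((adj M *v x) $ j))\<^sup>2) = (norm x)\<^sup>2" if "unitary M" for M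
    using norm_unitary [OF unitary_adj [OF that]] by (metis norm_sq_vec)
  have "a * (norm x)\<^sup>2 = (\<Sum>j\<in>UNIV. a * (cmod ((adj V *v x) $ j))\<^sup>2)"
    using norms [of V] K by (simp add: diagonalizes_def flip: sum_distrib_left)
  also have "\<dots> \<le> (\<Sum>j\<in>UNIV. \<kappa> $ j * (cmod ((adj V *v x) $ j))\<^sup>2)"
    using kI zero(2) by (intro sum_mono) (metis mult_right_mono zero_le_power2 norm_zero
        zero_power2 mult_zero_right order_refl)
  also have "\<dots> = Re (cinner x (K *v x))"
    by (simp add: cinner_diagonalizes [OF K])
  also have "\<dots> = Re (cinner x ((K + Y) *v x))"
  proof -
    have "Re (cinner x (Y *v x)) = (\<Sum>j\<in>UNIV. y $ j * (cmod ((adj W *v x) $ j))\<^sup>2)"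
      by (rule cinner_diagonalizes [OF Y])
    also have "\<dots> = 0"
      using J zero(1) by (intro sum.neutral) (metis mult_eq_0_iff norm_zero zero_power2)
    finally show ?thesis
      by (simp add: matrix_vector_mult_add_rdistrib cinner_add_right)
  qed
  also have "\<dots> = (\<Sum>j\<in>UNIV. l $ j * (cmod ((adj U *v x) $ j))\<^sup>2)"
    by (rule cinner_diagonalizes [OF L])
  also have "\<dots> \<le> (\<Sum>j\<in>UNIV. b * (cmod ((adj U *v x) $ j))\<^sup>2)"
    using lI zero(3) by (intro sum_mono) (metis mult_right_mono zero_le_power2 norm_zero
        zero_power2 mult_zero_right order_refl)
  also have "\<dots> = b * (norm x)\<^sup>2"
    using norms [of U] L by (simp add: diagonalizes_def flip: sum_distrib_left)
  finally show ?thesis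
    using x(1) by simp
qed

definition sorts :: "(nat \<Rightarrow> 'n) \<Rightarrow> real^'n \<Rightarrow> bool" where
  "sorts h d \<longleftrightarrow> bij_betw h {..<CARD('n)} UNIV \<and>
     (\<forall>i j. i \<le> j \<longrightarrow> j < CARD('n) \<longrightarrow> d $ h i \<le> d $ h j)"

lemma exists_sorts:
  fixes d :: "real^'n"
  obtains h where "sorts h d"
proof -
  obtain xs where xs: "set xs = (UNIV :: 'n set)" "distinct xs"
    using finite_distinct_list [OF finite] by blast
  define ys where "ys = sort_key (\<lambda>i. d $ i) xs"
  have ys: "set ys = UNIV" "distinct ys" "sorted (map (\<lambda>i. d $ i) ys)"
    using xs by (simp_all add: ys_def)
  then have len: "length ys = CARD('n)"
    by (metis distinct_card)
  have "bij_betw ((!) ys) {..<CARD('n)} UNIV"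
    using bij_betw_nth [OF ys(2)] ys(1) len by simp
  moreover have "d $ (ys ! i) \<le> d $ (ys ! j)" if "i \<le> j" "j < CARD('n)" for i j
    using sorted_nth_mono [OF ys(3), of i j] that len by simp
  ultimately have "sorts ((!) ys) d"
    by (simp add: sorts_def)
  then show ?thesis
    by (rule that)
qed

text \<open>A perturbation of rank at most \<open>n - k\<close> cannot push the \<open>k\<close> largest eigenvalues of \<open>K + Y\<close> below the
  corresponding \<open>k\<close> smallest ones of \<open>K\<close>; the remaining eigenvalues only add positive terms to the
  trace.\<close>

lemma smallest_exp_sum_le_trace_exp:
  fixes K Y :: "complex^'n^'n"
  assumes K: "diagonalizes V \<kappa> K" and h: "sorts h \<kappa>"
    and Y: "diagonalizes W y Y" and J: "\<And>j. j \<notin> J \<Longrightarrow> y $ j = 0"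
    and k: "card J + k = CARD('n)"
  shows "(\<Sum>i<k. exp (\<kappa> $ h i)) \<le> re_trace (matrix_exp (K + Y))"
proof -
  have "hermitian (K + Y)"
    using hermitian_diagonalizes [OF K] hermitian_diagonalizes [OF Y] by (simp add: hermitian_def)
  then obtain U l where L: "diagonalizes U l (K + Y)"
    using hermitian_diagonalizable by blast
  obtain g where g: "sorts g l"
    by (rule exists_sorts)
  have inj: "inj_on h {..<CARD('n)}" "inj_on g {..<CARD('n)}"
    and surj: "h ` {..<CARD('n)} = UNIV" "g ` {..<CARD('n)} = UNIV"
    using h g by (auto simp: sorts_def bij_betw_def)
  have le: "\<kappa> $ h i \<le> l $ g (card J + i)" if "i < k" for i
  proof (rule eigenvalue_interlacing [OF K Y L J])
    have "card (h ` {..<i}) = i"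
      using that k by (subst card_image) (auto intro: inj_on_subset [OF inj(1)])
    moreover have "card (g ` {card J + i<..<CARD('n)}) = CARD('n) - Suc (card J + i)"
      by (subst card_image) (auto intro: inj_on_subset [OF inj(2)])
    ultimately show "card J + card (h ` {..<i}) + card (g ` {card J + i<..<CARD('n)}) < CARD('n)"
      using that k by linarith
    show "\<kappa> $ h i \<le> \<kappa> $ j" if "j \<notin> h ` {..<i}" for j
    proof -
      obtain m where m: "j = h m" "m < CARD('n)"
        using surj(1) by (metis UNIV_I imageE lessThan_iff)
      with that have "i \<le> m"
        by (metis imageI lessThan_iff not_le)
      with m h show ?thesis
        by (simp add: sorts_def)
    qed
    show "l $ j \<le> l $ g (card J + i)" if "j \<notin> g ` {card J + i<..<CARD('n)}" for j
    proof -
      obtain m where m: "j = g m" "m < CARD('n)"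
        using surj(2) by (metis UNIV_I imageE lessThan_iff)
      with that have "m \<le> card J + i"
        by (metis imageI greaterThanLessThan_iff not_le)
      with g \<open>i < k\<close> k m(1) show ?thesis
        by (simp add: sorts_def)
    qed
  qed
  have "(\<Sum>i<k. exp (\<kappa> $ h i)) \<le> (\<Sum>i<k. exp (l $ g (card J + i)))"
    by (intro sum_mono) (simp add: le)
  also have "\<dots> = (\<Sum>j\<in>(\<lambda>i. g (card J + i)) ` {..<k}. exp (l $ j))"
    using k by (subst sum.reindex) (auto simp: inj_on_def dest: inj_onD [OF inj(2)])
  also have "\<dots> \<le> (\<Sum>j\<in>UNIV. exp (l $ j))"
    by (intro sum_mono2) auto
  also have "\<dots> = re_trace (matrix_exp (K + Y))"
    using re_trace_diagonalizes [OF matrix_fun_diagonalizes [OF L, of exp]]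
    by (simp add: matrix_exp_def)
  finally show ?thesis .
qed

lemma log_sum_add: "log_sum (H + Y) p A = log_sum H p A + Y"
  by (simp add: log_sum_def)

text \<open>The index set \<open>I\<close> may be arbitrary: subtracting \<open>t\<close> from \<open>H\<close> on the eigenvectors of the combined
  matrix outside \<open>I\<close> removes their contribution to its trace as \<open>t \<rightarrow> \<infinity>\<close>, while the traces for \<open>A\<close>
  and \<open>B\<close> stay above the sums of their smallest eigenvalues.\<close>

theorem smallest_exp_sum_concave:
  fixes p :: "'m::finite \<Rightarrow> real" and H :: "complex^'n^'n"
  assumes H: "hermitian H" and p: "\<And>j. 0 \<le> p j" "(\<Sum>j\<in>UNIV. p j) \<le> 1"
    and A: "\<And>j. pos_def (A j)" and B: "\<And>j. pos_def (B j)"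
    and uv: "0 \<le> u" "0 \<le> v" "u + v = 1"
    and KA: "diagonalizes VA \<alpha> (log_sum H p A)" "sorts hA \<alpha>"
    and KB: "diagonalizes VB \<beta> (log_sum H p B)" "sorts hB \<beta>"
    and KC: "diagonalizes W \<gamma> (log_sum H p (\<lambda>j. u *\<^sub>R A j + v *\<^sub>R B j))"
  shows "u * (\<Sum>i<card I. exp (\<alpha> $ hA i)) + v * (\<Sum>i<card I. exp (\<beta> $ hB i)) \<le>
    (\<Sum>j\<in>I. exp (\<gamma> $ j))"
proof -
  let ?lhs = "u * (\<Sum>i<card I. exp (\<alpha> $ hA i)) + v * (\<Sum>i<card I. exp (\<beta> $ hB i))"
  let ?R = "\<Sum>j\<in>-I. exp (\<gamma> $ j)"
  have W: "unitary W"
    using KC by (simp add: diagonalizes_def)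
  have card: "card (- I) + card I = CARD('n)"
    by (metis Compl_partition2 card_Un_disjoint finite inf_compl_bot inf_commute)
  have bound: "?lhs \<le> (\<Sum>j\<in>I. exp (\<gamma> $ j)) + exp (- t) * ?R" for t
  proof -
    define y :: "real^'n" where "y = (\<chi> j. if j \<in> I then 0 else - t)"
    define Y where "Y = W ** real_diag y ** adj W"
    have Y: "diagonalizes W y Y"
      using W by (simp add: diagonalizes_def Y_def)
    have y0: "y $ j = 0" if "j \<notin> - I" for j
      using that by (simp add: y_def)
    have "hermitian (H + Y)"
      using H hermitian_diagonalizes [OF Y] by (simp add: hermitian_def)
    then have "u * re_trace (matrix_exp (log_sum H p A + Y)) + v * re_trace (matrix_exp (log_sum H p B + Y))
        \<le> re_trace (matrix_exp (log_sum H p (\<lambda>j. u *\<^sub>R A j + v *\<^sub>R B j) + Y))"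
      using lieb_concavity [of "H + Y" p A B u v] p A B uv by (simp add: log_sum_add)
    moreover have "(\<Sum>i<card I. exp (\<alpha> $ hA i)) \<le> re_trace (matrix_exp (log_sum H p A + Y))"
      by (rule smallest_exp_sum_le_trace_exp [OF KA Y y0 card])
    moreover have "(\<Sum>i<card I. exp (\<beta> $ hB i)) \<le> re_trace (matrix_exp (log_sum H p B + Y))"
      by (rule smallest_exp_sum_le_trace_exp [OF KB Y y0 card])
    ultimately have "?lhs \<le> re_trace (matrix_exp (log_sum H p (\<lambda>j. u *\<^sub>R A j + v *\<^sub>R B j) + Y))"
      using uv by (meson add_mono mult_left_mono order_trans)
    also have "\<dots> = (\<Sum>j\<in>UNIV. exp (\<gamma> $ j + y $ j))"
      using re_trace_diagonalizes [OF matrix_fun_diagonalizes [OF diagonalizes_add [OF KC Y], of exp]]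
      by (simp add: matrix_exp_def)
    also have "\<dots> = (\<Sum>j\<in>I. exp (\<gamma> $ j + y $ j)) + (\<Sum>j\<in>-I. exp (\<gamma> $ j + y $ j))"
      by (subst sum.union_disjoint [symmetric]) auto
    also have "\<dots> = (\<Sum>j\<in>I. exp (\<gamma> $ j)) + exp (- t) * ?R"
      by (simp add: y_def exp_diff exp_minus sum_distrib_left field_simps)
    finally show ?thesis .
  qed
  have "((\<lambda>t. (\<Sum>j\<in>I. exp (\<gamma> $ j)) + exp (- t) * ?R) \<longlongrightarrow> (\<Sum>j\<in>I. exp (\<gamma> $ j)) + 0 * ?R) at_top"
    by (intro tendsto_intros filterlim_compose [OF exp_at_bot filterlim_uminus_at_bot_at_top])
  then have "?lhs \<le> (\<Sum>j\<in>I. exp (\<gamma> $ j)) + 0 * ?R"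
    by (rule tendsto_lowerbound) (simp_all only: bound always_eventually simp_thms trivial_limit_at_top_linorder)
  then show ?thesis
    by simp
qed

section \<open>Symmetric monotone concave functions of the eigenvalues\<close>

text \<open>Induction gives \<open>w\<^sub>k (e\<^sub>0 + \<dots> + e\<^sub>k) \<le> w\<^sub>0 e\<^sub>0 + \<dots> + w\<^sub>k e\<^sub>k\<close>.\<close>

lemma abel_summation_nonneg:
  fixes w e :: "nat \<Rightarrow> real"
  assumes "\<And>i. Suc i < n \<Longrightarrow> w (Suc i) \<le> w i" and "\<And>i. i < n \<Longrightarrow> 0 \<le> w i"
    and partial: "\<And>k. k \<le> n \<Longrightarrow> 0 \<le> (\<Sum>i<k. e i)"
  shows "0 \<le> (\<Sum>i<n. w i * e i)"
proof -
  have "w k * (\<Sum>i<Suc k. e i) \<le> (\<Sum>i<Suc k. w i * e i)" if "k < n" for k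
    using that
  proof (induction k)
    case (Suc k)
    have "w (Suc k) * (\<Sum>i<Suc k. e i) \<le> w k * (\<Sum>i<Suc k. e i)"
      using Suc.prems assms(1) partial [of "Suc k"] by (intro mult_right_mono) simp_all
    with Suc show ?case
      by (simp add: distrib_left)
  qed simp
  moreover have "0 \<le> w (n - 1) * (\<Sum>i<Suc (n - 1). e i)" if "n > 0"
    using that assms(2) [of "n - 1"] partial [of n] by simp
  ultimately show ?thesis
    by (cases n) (force)+
qed

text \<open>A hyperplane separates the hypograph of \<open>\<phi>\<close> from the open ray above \<open>(x, \<phi> x)\<close>. It is not vertical
  because \<open>x\<close> lies in the interior of the orthant.\<close>

lemma concave_monotone_supergradient:
  fixes \<phi> :: "real^'n \<Rightarrow> real"
  assumes concave: "concave_on nonneg_orthant \<phi>" and mono: "mono_on nonneg_orthant \<phi>"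
    and x: "\<And>i. 0 < x $ i"
  obtains w where "\<And>i. 0 \<le> w $ i"
    and "\<And>y. y \<in> nonneg_orthant \<Longrightarrow> \<phi> y \<le> \<phi> x + w \<bullet> (y - x)"
proof -
  define S where "S = {(y, r). y \<in> nonneg_orthant \<and> r \<le> \<phi> y}"
  define T where "T = {x} \<times> {\<phi> x<..}"
  have xO: "x \<in> nonneg_orthant"
    using x by (simp add: nonneg_orthant_def less_imp_le)
  have "convex S"
  proof (rule convexI, clarsimp simp: S_def)
    fix y1 y2 r1 r2 and u v :: real
    assume *: "y1 \<in> nonneg_orthant" "y2 \<in> nonneg_orthant" "r1 \<le> \<phi> y1" "r2 \<le> \<phi> y2"
      "0 \<le> u" "0 \<le> v" "u + v = 1"
    then have "u * r1 + v * r2 \<le> u * \<phi> y1 + v * \<phi> y2"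
      by (intro add_mono mult_left_mono)
    with * concave show "u *\<^sub>R y1 + v *\<^sub>R y2 \<in> nonneg_orthant \<and> u * r1 + v * r2 \<le> \<phi> (u *\<^sub>R y1 + v *\<^sub>R y2)"
      unfolding concave_on_iff convex_def by (meson order_trans)
  qed
  moreover have "convex T"
    unfolding T_def by (intro convex_Times) auto
  moreover have "S \<noteq> {}" "T \<noteq> {}" "S \<inter> T = {}"
    using xO by (auto simp: S_def T_def intro: exI [of _ "\<phi> x + 1"])
  ultimately obtain n c where n: "n \<noteq> 0" and nS: "\<And>z. z \<in> S \<Longrightarrow> n \<bullet> z \<le> c"
    and nT: "\<And>z. z \<in> T \<Longrightarrow> c \<le> n \<bullet> z"
    using separating_hyperplane_sets by metis
  obtain a b where ab: "n = (a, b)"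
    by (cases n)
  have S: "a \<bullet> y + b * r \<le> c" if "y \<in> nonneg_orthant" "r \<le> \<phi> y" for y r
    using nS [of "(y, r)"] that by (simp add: S_def ab)
  have T: "c \<le> a \<bullet> x + b * r" if "r > \<phi> x" for r
    using nT [of "(x, r)"] that by (simp add: T_def ab)
  have "0 \<le> b"
    using T [of "\<phi> x + 1"] S [OF xO, of "\<phi> x"] by (simp add: algebra_simps)
  have Tx: "c \<le> a \<bullet> x + b * \<phi> x"
  proof (rule field_le_epsilon)
    fix e :: real assume "e > 0"
    \<comment> \<open>The ray contains \<open>(x, \<phi> x + \<delta>)\<close> for every \<open>\<delta> > 0\<close>; the choice of \<open>\<delta>\<close> makes \<open>b \<delta> \<le> e\<close>,
       also when \<open>b = 0\<close>.\<close>
    have "b * (e / (b + 1)) \<le> e"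
      using \<open>0 \<le> b\<close> \<open>e > 0\<close> by (simp add: divide_simps)
    moreover have "c \<le> a \<bullet> x + b * (\<phi> x + e / (b + 1))"
      using \<open>0 \<le> b\<close> \<open>e > 0\<close> by (intro T) simp
    ultimately show "c \<le> a \<bullet> x + b * \<phi> x + e"
      by (simp add: distrib_left)
  qed
  have main: "a \<bullet> (y - x) + b * (\<phi> y - \<phi> x) \<le> 0" if "y \<in> nonneg_orthant" for y
    using S [OF that order_refl] Tx by (simp add: inner_diff_right right_diff_distrib)
  have "b \<noteq> 0"
  proof
    assume "b = 0"
    have "a $ i = 0" for i
    proof -
      define y1 where "y1 = x + axis i (x $ i)"
      define y2 where "y2 = x - axis i (x $ i)"
      have "y1 \<in> nonneg_orthant" "y2 \<in> nonneg_orthant"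
        using x by (auto simp: y1_def y2_def nonneg_orthant_def axis_def less_imp_le add_nonneg_nonneg)
      then have "a \<bullet> axis i (x $ i) \<le> 0" "0 \<le> a \<bullet> axis i (x $ i)"
        using main \<open>b = 0\<close> by (fastforce simp: y1_def y2_def)+
      then show ?thesis
        using x [of i] by (simp add: inner_axis)
    qed
    then show False
      using n ab \<open>b = 0\<close> by (simp add: vec_eq_iff zero_prod_def)
  qed
  with \<open>0 \<le> b\<close> have b: "b > 0"
    by simp
  define w where "w = (- 1 / b) *\<^sub>R a"
  have super: "\<phi> y \<le> \<phi> x + w \<bullet> (y - x)" if "y \<in> nonneg_orthant" for y
    using main [OF that] b by (simp add: w_def field_simps)
  moreover have "0 \<le> w $ i" for i
  proof -
    have y: "x + axis i 1 \<in> nonneg_orthant"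
      using xO by (simp add: nonneg_orthant_def axis_def)
    have "x \<le> x + axis i 1"
      by (simp add: less_eq_vec_def axis_def)
    then have "\<phi> x \<le> \<phi> (x + axis i 1)"
      using mono xO y by (simp add: mono_onD)
    with super [OF y] show ?thesis
      by (simp add: inner_axis)
  qed
  ultimately show ?thesis
    using that by blast
qed

lemma symmetric_form_bij:
  fixes d :: "real^'n"
  assumes "symmetric_form \<phi>" "d \<in> nonneg_orthant" "bij \<pi>"
  shows "\<phi> (\<chi> j. d $ \<pi> j) = \<phi> d"
proof -
  have "\<pi> permutes UNIV"
    using assms(3) by (rule bij_imp_permutes) simp
  with assms show ?thesis
    by (simp add: symmetric_form_def)
qed

text \<open>A supergradient \<open>w \<ge> 0\<close> at \<open>x\<close> reduces the inequality for \<open>\<phi>\<close> to one for the linear form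
  \<open>w\<close>. Since \<open>\<phi>\<close> is symmetric, \<open>y\<close> and \<open>z\<close> may be rearranged so that their smallest
  entries meet the largest weights; summation by parts then only involves partial sums of
  smallest entries.\<close>

lemma symmetric_concave_of_partial_sums:
  fixes \<phi> :: "real^'n \<Rightarrow> real" and x y z :: "real^'n"
  assumes \<phi>: "symmetric_form \<phi>" "mono_on nonneg_orthant \<phi>" "concave_on nonneg_orthant \<phi>"
    and x: "\<And>i. 0 < x $ i" and yz: "y \<in> nonneg_orthant" "z \<in> nonneg_orthant"
    and h: "sorts hy y" "sorts hz z"
    and uv: "0 \<le> u" "0 \<le> v" "u + v = 1"
    and partial: "\<And>I. u * (\<Sum>i<card I. y $ hy i) + v * (\<Sum>i<card I. z $ hz i) \<le> (\<Sum>j\<in>I. x $ j)"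
  shows "u * \<phi> y + v * \<phi> z \<le> \<phi> x"
proof -
  obtain w where w: "\<And>i. 0 \<le> w $ i"
    and super: "\<And>y. y \<in> nonneg_orthant \<Longrightarrow> \<phi> y \<le> \<phi> x + w \<bullet> (y - x)"
    using concave_monotone_supergradient \<phi> x by metis
  \<comment> \<open>\<open>g\<close> lists the weights in decreasing order.\<close>
  obtain g where "sorts g (- w)"
    by (rule exists_sorts)
  then have g: "bij_betw g {..<CARD('n)} UNIV"
    and dec: "\<And>i. Suc i < CARD('n) \<Longrightarrow> w $ g (Suc i) \<le> w $ g i"
    by (auto simp: sorts_def)
  define g' where "g' = the_inv_into {..<CARD('n)} g"
  have g': "bij_betw g' UNIV {..<CARD('n)}"
    unfolding g'_def by (rule bij_betw_the_inv_into [OF g])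
  have g'g: "g' (g i) = i" if "i < CARD('n)" for i
    using g that by (simp add: g'_def the_inv_into_f_f bij_betw_def)
  have rearranged: "\<phi> d \<le> \<phi> x + (\<Sum>i<CARD('n). w $ g i * (d $ hd i - x $ g i))"
    if d: "d \<in> nonneg_orthant" and hd: "sorts hd d" for d hd
  proof -
    have "bij (\<lambda>j. hd (g' j))"
      using bij_betw_trans [OF g'] hd by (auto simp: sorts_def o_def)
    then have "\<phi> d = \<phi> (\<chi> j. d $ hd (g' j))"
      using symmetric_form_bij [OF \<phi>(1) d] by metis
    also have "\<dots> \<le> \<phi> x + w \<bullet> ((\<chi> j. d $ hd (g' j)) - x)"
      using d by (intro super) (simp add: nonneg_orthant_def)
    also have "w \<bullet> ((\<chi> j. d $ hd (g' j)) - x) = (\<Sum>j\<in>UNIV. w $ j * (d $ hd (g' j) - x $ j))"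
      by (simp add: inner_vec_def)
    also have "\<dots> = (\<Sum>i<CARD('n). w $ g i * (d $ hd i - x $ g i))"
      by (subst sum.reindex_bij_betw [OF g, symmetric]) (simp add: g'g)
    finally show ?thesis .
  qed
  have "0 \<le> (\<Sum>i<CARD('n). w $ g i * (x $ g i - (u * y $ hy i + v * z $ hz i)))"
  proof (rule abel_summation_nonneg)
    show "w $ g (Suc i) \<le> w $ g i" if "Suc i < CARD('n)" for i
      by (rule dec [OF that])
    show "0 \<le> w $ g i" for i
      by (rule w)
    fix k assume "k \<le> CARD('n)"
    then have inj: "inj_on g {..<k}"
      using g by (auto simp: bij_betw_def intro: inj_on_subset)
    then have "(\<Sum>j\<in>g ` {..<k}. x $ j) = (\<Sum>i<k. x $ g i)" "card (g ` {..<k}) = k"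
      by (simp_all add: sum.reindex card_image)
    then show "0 \<le> (\<Sum>i<k. x $ g i - (u * y $ hy i + v * z $ hz i))"
      using partial [of "g ` {..<k}"] by (simp add: sum_subtractf sum.distrib sum_distrib_left)
  qed
  also have "\<dots> = - (u * (\<Sum>i<CARD('n). w $ g i * (y $ hy i - x $ g i)) +
      v * (\<Sum>i<CARD('n). w $ g i * (z $ hz i - x $ g i)))"
  proof -
    have v: "v = 1 - u"
      using uv by simp
    show ?thesis
      unfolding v sum_distrib_left sum.distrib [symmetric] sum_negf [symmetric]
      by (intro sum.cong refl) (simp add: algebra_simps)
  qed
  finally have "u * (\<Sum>i<CARD('n). w $ g i * (y $ hy i - x $ g i)) +
      v * (\<Sum>i<CARD('n). w $ g i * (z $ hz i - x $ g i)) \<le> 0"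
    by simp
  moreover have "u * \<phi> y + v * \<phi> z \<le> u * (\<phi> x + (\<Sum>i<CARD('n). w $ g i * (y $ hy i - x $ g i))) +
      v * (\<phi> x + (\<Sum>i<CARD('n). w $ g i * (z $ hz i - x $ g i)))"
    by (intro add_mono mult_left_mono rearranged yz h uv)
  moreover have "u * \<phi> x + v * \<phi> x = \<phi> x"
    using uv by (simp flip: distrib_right)
  ultimately show ?thesis
    by (simp add: distrib_left)
qed

lemma spectral_extension_exp_log_sum_concave:
  fixes \<phi> :: "real^'n \<Rightarrow> real" and H :: "complex^'n^'n" and p :: "'m::finite \<Rightarrow> real"
  assumes \<phi>: "symmetric_form \<phi>" "mono_on nonneg_orthant \<phi>" "concave_on nonneg_orthant \<phi>"
    and H: "hermitian H" and p: "\<And>j. 0 \<le> p j" "(\<Sum>j\<in>UNIV. p j) \<le> 1"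
    and A: "\<And>j. pos_def (A j)" and B: "\<And>j. pos_def (B j)"
    and uv: "0 \<le> u" "0 \<le> v" "u + v = 1"
  shows "u * spectral_extension \<phi> (matrix_exp (log_sum H p A)) +
      v * spectral_extension \<phi> (matrix_exp (log_sum H p B)) \<le>
    spectral_extension \<phi> (matrix_exp (log_sum H p (\<lambda>j. u *\<^sub>R A j + v *\<^sub>R B j)))"
proof -
  let ?C = "\<lambda>j. u *\<^sub>R A j + v *\<^sub>R B j"
  have C: "pos_def (?C j)" for j
    by (intro pos_def_convex_combination A B uv)
  obtain VA \<alpha> where KA: "diagonalizes VA \<alpha> (log_sum H p A)"
    by (rule hermitian_diagonalizable [OF hermitian_log_sum [OF H A]])
  obtain VB \<beta> where KB: "diagonalizes VB \<beta> (log_sum H p B)"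
    by (rule hermitian_diagonalizable [OF hermitian_log_sum [OF H B]])
  obtain W \<gamma> where KC: "diagonalizes W \<gamma> (log_sum H p ?C)"
    by (rule hermitian_diagonalizable [OF hermitian_log_sum [OF H C]])
  obtain hA where hA: "sorts hA \<alpha>"
    by (rule exists_sorts)
  obtain hB where hB: "sorts hB \<beta>"
    by (rule exists_sorts)
  define vexp where "vexp = (\<lambda>d::real^'n. \<chi> i. exp (d $ i))"
  have spec: "spectral_extension \<phi> (matrix_exp K) = \<phi> (vexp d)" if "diagonalizes V d K" for V d K
    using spectral_extension_diagonalizes [OF \<phi>(1) matrix_fun_diagonalizes [OF that, of exp]]
    by (simp add: vexp_def matrix_exp_def)
  have sorts: "sorts h (vexp d)" if "sorts h d" for h d
    using that by (simp add: sorts_def vexp_def)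
  have "u * \<phi> (vexp \<alpha>) + v * \<phi> (vexp \<beta>) \<le> \<phi> (vexp \<gamma>)"
  proof (rule symmetric_concave_of_partial_sums [OF \<phi> _ _ _ sorts [OF hA] sorts [OF hB] uv])
    show "u * (\<Sum>i<card I. vexp \<alpha> $ hA i) + v * (\<Sum>i<card I. vexp \<beta> $ hB i)
        \<le> (\<Sum>j\<in>I. vexp \<gamma> $ j)" for I
      using smallest_exp_sum_concave [OF H p A B uv KA hA KB hB KC] by (simp add: vexp_def)
  qed (simp_all add: vexp_def nonneg_orthant_def)
  then show ?thesis
    by (simp add: spec [OF KA] spec [OF KB] spec [OF KC])
qed

theorem theorem2p6:
  fixes \<phi> :: "real^'n \<Rightarrow> real"
    and H :: "complex^'n^'n"
    and p :: "'m::finite \<Rightarrow> real"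
  assumes "symmetric_form \<phi>"
    and "mono_on nonneg_orthant \<phi>"
    and "concave_on nonneg_orthant \<phi>"
    and "hermitian H"
    and "\<And>j. p j \<in> {0..1}"
    and "(\<Sum>j\<in>UNIV. p j) \<le> 1"
  shows "concave_on {A :: complex^'n^'n^'m. \<forall>j. pos_def (A $ j)}
           (\<lambda>A. spectral_extension \<phi>
              (matrix_exp (H + (\<Sum>j\<in>UNIV. p j *\<^sub>R matrix_log (A $ j)))))
       \<and> concave_on {A :: complex^'n^'n. pos_def A}
           (\<lambda>A. spectral_extension \<phi> (matrix_exp (H + matrix_log A)))"
proof (intro conjI)
  have p: "0 \<le> p j" for j
    using assms(5) [of j] by simp
  show "concave_on {A :: complex^'n^'n^'m. \<forall>j. pos_def (A $ j)}
      (\<lambda>A. spectral_extension \<phi> (matrix_exp (H + (\<Sum>j\<in>UNIV. p j *\<^sub>R matrix_log (A $ j)))))"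
    unfolding concave_on_iff
  proof (intro conjI ballI allI impI)
    show "convex {A :: complex^'n^'n^'m. \<forall>j. pos_def (A $ j)}"
      by (auto simp: convex_def intro: pos_def_convex_combination)
    fix A B :: "complex^'n^'n^'m" and u v :: real
    assume "A \<in> {A. \<forall>j. pos_def (A $ j)}" "B \<in> {A. \<forall>j. pos_def (A $ j)}"
      and uv: "0 \<le> u" "0 \<le> v" "u + v = 1"
    then show "u * spectral_extension \<phi> (matrix_exp (H + (\<Sum>j\<in>UNIV. p j *\<^sub>R matrix_log (A $ j)))) +
        v * spectral_extension \<phi> (matrix_exp (H + (\<Sum>j\<in>UNIV. p j *\<^sub>R matrix_log (B $ j))))
      \<le> spectral_extension \<phi>
          (matrix_exp (H + (\<Sum>j\<in>UNIV. p j *\<^sub>R matrix_log ((u *\<^sub>R A + v *\<^sub>R B) $ j))))"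
      using spectral_extension_exp_log_sum_concave
        [OF assms(1-4) p assms(6), of "\<lambda>j. A $ j" "\<lambda>j. B $ j" u v]
      by (simp add: log_sum_def)
  qed
  show "concave_on {A :: complex^'n^'n. pos_def A}
      (\<lambda>A. spectral_extension \<phi> (matrix_exp (H + matrix_log A)))"
    unfolding concave_on_iff
  proof (intro conjI ballI allI impI)
    show "convex {A :: complex^'n^'n. pos_def A}"
      by (auto simp: convex_def intro: pos_def_convex_combination)
    fix A B :: "complex^'n^'n" and u v :: real
    assume "A \<in> {A. pos_def A}" "B \<in> {A. pos_def A}" and uv: "0 \<le> u" "0 \<le> v" "u + v = 1"
    then show "u * spectral_extension \<phi> (matrix_exp (H + matrix_log A)) +
        v * spectral_extension \<phi> (matrix_exp (H + matrix_log B))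
      \<le> spectral_extension \<phi> (matrix_exp (H + matrix_log (u *\<^sub>R A + v *\<^sub>R B)))"
      using spectral_extension_exp_log_sum_concave
        [OF assms(1-4), of "\<lambda>_ :: unit. 1" "\<lambda>_. A" "\<lambda>_. B" u v]
      by (simp add: log_sum_def)
  qed
qed

end
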